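(* For every nontrivial oriented link $L$ in $S^3$, \[ td(L)\ \ge\ \deg_z P_L(a,z), \] where $td(L)$ is the skein tree depth of $L$ and $\deg_z P_L(a,z)$ is the degree in the variable $z$ of the HOMFLY-PT polynomial $P_L(a,z)$ of $L$.
   Context: Links are oriented links in $S^3$, with one or more components, considered up to ambient isotopy; a knot is a one-component link. An unlink (trivial link) is a link isotopic to a disjoint union of $r\ge 1$ unlinked unknotted circles; a link is nontrivial if it is not an unlink. Skein triples. $L_+,L_-,L_0$ denote three oriented links having diagrams that are identical except near one crossing, where $L_+$ has a positive crossing, $L_-$ has a negative crossing, and $L_0$ has the oriented smoothing of that crossing. Skein tree. A skein tree for $L$ is a finite rooted binary tree whose nodes are oriented links (given by diagrams, where the diagram of any node may be replaced by any other diagram of an isotopic link), whose root is $L$, whose leaves are unlinks, and in which each non-leaf node has exactly two children, obtained by choosing a crossing in a diagram of the node and performing a skein resolution there: if the crossing is positive (the node is $L_+$) the children are $L_-$ and $L_0$; if it is negative (the node is $L_-$) the children are $L_+$ and $L_0$. The depth of a skein tree is the number of edges in its longest root-to-leaf path. The skein tree depth $td(L)$ is the minimum depth over all skein trees for $L$ (so $td$ of an unlink is $0$). HOMFLY-PT polynomial. $P_L(a,z)$ is the Laurent polynomial invariant of oriented links determined by $P_{\text{unknot}}(a,z)=1$ and \[a^{-1}P_{L_+}(a,z)-a\,P_{L_-}(a,z)=z\,P_{L_0}(a,z)\] for every skein triple. $\deg_z P_L(a,z)$ is the highest exponent of $z$ occurring in $P_L(a,z)$ with nonzero coefficient. *)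

theory Defs
  imports "HOL-Analysis.Analysis" "HOL-Library.Poly_Mapping"
begin

section \<open>Oriented links in the 3-sphere\<close>

text \<open>Euclidean 3-space is written as \<open>\<complex> \<times> \<real>\<close>: the first component is the plane onto which
  diagrams are projected, the second one is the height. The 3-sphere is the unit sphere of
  the Euclidean 4-space \<open>(\<complex> \<times> \<real>) \<times> \<real>\<close>.\<close>

type_synonym space3 = "complex \<times> real"
type_synonym space4 = "space3 \<times> real"

abbreviation S3 :: "space4 set" where
  "S3 \<equiv> sphere 0 1"

text \<open>Inverse stereographic projection, identifying 3-space with \<open>S3\<close> minus the point \<open>(0, 1)\<close>.\<close>

definition stereo :: "space3 \<Rightarrow> space4" where
  "stereo x = ((2 / ((norm x)\<^sup>2 + 1)) *\<^sub>R x, ((norm x)\<^sup>2 - 1) / ((norm x)\<^sup>2 + 1))"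

text \<open>An embedded circle is parametrized by \<open>\<real>/\<int>\<close>, that is, by a function of period 1
  on the line. Its orientation is the direction of increasing parameter.\<close>

definition embedded_circle :: "(real \<Rightarrow> 'a::topological_space) \<Rightarrow> bool" where
  "embedded_circle \<gamma> \<longleftrightarrow> continuous_on UNIV \<gamma> \<and> (\<forall>s t. \<gamma> s = \<gamma> t \<longleftrightarrow> s - t \<in> \<int>)"

definition same_oriented_circle :: "(real \<Rightarrow> 'a) \<Rightarrow> (real \<Rightarrow> 'a) \<Rightarrow> bool" where
  "same_oriented_circle \<gamma> \<delta> \<longleftrightarrow>
     (\<exists>\<phi> :: real \<Rightarrow> real. continuous_on UNIV \<phi> \<and> strict_mono \<phi> \<and>
        (\<forall>t. \<phi> (t + 1) = \<phi> t + 1) \<and> \<delta> = \<gamma> \<circ> \<phi>)"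

text \<open>A family of disjoint oriented circles is given by the set of its parametrized components.\<close>

definition oriented_circles :: "(real \<Rightarrow> 'a::topological_space) set \<Rightarrow> bool" where
  "oriented_circles L \<longleftrightarrow> finite L \<and> L \<noteq> {} \<and> (\<forall>\<gamma>\<in>L. embedded_circle \<gamma>) \<and>
     pairwise (\<lambda>\<gamma> \<delta>. disjnt (range \<gamma>) (range \<delta>)) L"

definition ambient_isotopy :: "(real \<Rightarrow> space4 \<Rightarrow> space4) \<Rightarrow> bool" where
  "ambient_isotopy H \<longleftrightarrow>
     continuous_on ({0..1} \<times> S3) (\<lambda>(t, x). H t x) \<and>
     (\<forall>t\<in>{0..1}. \<exists>G. homeomorphism S3 S3 (H t) G) \<and>
     (\<forall>x\<in>S3. H 0 x = x)"

definition isotopic :: "(real \<Rightarrow> space4) set \<Rightarrow> (real \<Rightarrow> space4) set \<Rightarrow> bool" where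
  "isotopic L M \<longleftrightarrow> (\<exists>H. ambient_isotopy H \<and>
     (\<forall>\<gamma>\<in>L. \<exists>\<delta>\<in>M. same_oriented_circle (H 1 \<circ> \<gamma>) \<delta>) \<and>
     (\<forall>\<delta>\<in>M. \<exists>\<gamma>\<in>L. same_oriented_circle (H 1 \<circ> \<gamma>) \<delta>))"


section \<open>Polygonal links and diagrams\<close>

text \<open>An oriented polygonal link in 3-space is given by the set of its directed edges.\<close>

definition carrier_of :: "(space3 \<times> space3) set \<Rightarrow> space3 set" where
  "carrier_of E = (\<Union>(u, v)\<in>E. closed_segment u v)"

definition polygonal_link :: "(space3 \<times> space3) set \<Rightarrow> bool" where
  "polygonal_link E \<longleftrightarrow> finite E \<and> E \<noteq> {} \<and>
     (\<forall>(u, v)\<in>E. u \<noteq> v \<and> (\<exists>!w. (v, w) \<in> E) \<and> (\<exists>!w. (w, u) \<in> E)) \<and>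
     (\<forall>(u, v)\<in>E. \<forall>(u', v')\<in>E. (u, v) \<noteq> (u', v') \<longrightarrow>
        closed_segment u v \<inter> closed_segment u' v' \<subseteq> {u, v} \<inter> {u', v'})"

text \<open>The circles in \<open>\<Gamma>\<close> run through the polygonal link \<open>E\<close>, each edge in its own direction.\<close>

definition traverses :: "(real \<Rightarrow> space3) set \<Rightarrow> (space3 \<times> space3) set \<Rightarrow> bool" where
  "traverses \<Gamma> E \<longleftrightarrow> oriented_circles \<Gamma> \<and> (\<Union>\<gamma>\<in>\<Gamma>. range \<gamma>) = carrier_of E \<and>
     (\<forall>(u, v)\<in>E. \<exists>\<gamma>\<in>\<Gamma>. \<exists>s t. s < t \<and> t < s + 1 \<and> \<gamma> s = u \<and> \<gamma> t = v \<and>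
        \<gamma> ` {s..t} = closed_segment u v)"

text \<open>\<open>L\<close> is ambient isotopic to the polygonal link \<open>E\<close>, viewed in the 3-sphere.\<close>

definition isotopic_to_polygonal :: "(real \<Rightarrow> space4) set \<Rightarrow> (space3 \<times> space3) set \<Rightarrow> bool" where
  "isotopic_to_polygonal L E \<longleftrightarrow>
     (\<exists>\<Gamma>. traverses \<Gamma> E \<and> isotopic ((\<lambda>\<gamma>. stereo \<circ> \<gamma>) ` \<Gamma>) L)"

text \<open>Links are tame: wild embeddings of circles are excluded by the last condition.\<close>

definition oriented_link :: "(real \<Rightarrow> space4) set \<Rightarrow> bool" where
  "oriented_link L \<longleftrightarrow> oriented_circles L \<and> (\<forall>\<gamma>\<in>L. range \<gamma> \<subseteq> S3) \<and>
     (\<exists>E. polygonal_link E \<and> isotopic_to_polygonal L E)"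

text \<open>A link diagram is the image of a polygonal link under a regular projection to the plane,
  together with the over/under information at the double points. Both are determined by the
  polygonal link itself. Regular means: there are finitely many multiple points, all of them are
  double, and no vertex lies over a double point (so that double points are transversal).\<close>

definition regular_projection :: "(space3 \<times> space3) set \<Rightarrow> bool" where
  "regular_projection E \<longleftrightarrow>
     finite {x. \<exists>p\<in>carrier_of E. \<exists>q\<in>carrier_of E. p \<noteq> q \<and> fst p = x \<and> fst q = x} \<and>
     (\<forall>x. card {p \<in> carrier_of E. fst p = x} \<le> 2) \<and>
     (\<forall>(u, v)\<in>E. \<forall>p\<in>carrier_of E. fst p = fst u \<longrightarrow> p = u)"

definition link_diagram :: "(space3 \<times> space3) set \<Rightarrow> bool" where
  "link_diagram E \<longleftrightarrow> polygonal_link E \<and> regular_projection E"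

definition has_diagram :: "(real \<Rightarrow> space4) set \<Rightarrow> (space3 \<times> space3) set \<Rightarrow> bool" where
  "has_diagram L E \<longleftrightarrow> oriented_link L \<and> link_diagram E \<and> isotopic_to_polygonal L E"


section \<open>Skein triples\<close>

text \<open>Three diagrams which share the edges \<open>R\<close> outside a convex quadrilateral of the plane with
  corners below \<open>a, b, c, d\<close>. Inside, the first two consist of a strand from \<open>a\<close> to \<open>b\<close> and a strand
  from \<open>c\<close> to \<open>d\<close>, which project to the diagonals. The strand from \<open>c\<close> to \<open>d\<close> is straight. The strand
  from \<open>a\<close> to \<open>b\<close> has a middle edge that passes above it in the first diagram (from \<open>p\<close> to \<open>q\<close>)
  and below it in the second one (from \<open>p'\<close> to \<open>q'\<close>). The third diagram has straight strands from
  \<open>a\<close> to \<open>d\<close> and from \<open>c\<close> to \<open>b\<close>, which is the smoothing compatible with the orientations.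

  \<open>Im (cnj u * v)\<close> is the determinant of the plane vectors \<open>u, v\<close>. A crossing with direction \<open>u\<close> of the
  upper and \<open>v\<close> of the lower strand is positive iff this is positive; hence the sign condition
  makes the crossing positive in the first and negative in the second diagram.\<close>

definition crosses_above :: "space3 \<Rightarrow> space3 \<Rightarrow> space3 \<Rightarrow> space3 \<Rightarrow> bool" where
  "crosses_above p q c d \<longleftrightarrow>
     (\<exists>x\<in>closed_segment p q. \<exists>y\<in>closed_segment c d. fst x = fst y \<and> snd x > snd y)"

definition skein_diagrams ::
  "(space3 \<times> space3) set \<Rightarrow> (space3 \<times> space3) set \<Rightarrow> (space3 \<times> space3) set \<Rightarrow> bool" where
  "skein_diagrams Ep Em E0 \<longleftrightarrow>
     link_diagram Ep \<and> link_diagram Em \<and> link_diagram E0 \<and>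
     (\<exists>R a b c d p q p' q'.
        Ep = R \<union> {(a, p), (p, q), (q, b), (c, d)} \<and>
        Em = R \<union> {(a, p'), (p', q'), (q', b), (c, d)} \<and>
        E0 = R \<union> {(a, d), (c, b)} \<and>
        fst p = fst p' \<and> fst q = fst q' \<and>
        fst p \<in> open_segment (fst a) (fst q) \<and> fst q \<in> open_segment (fst p) (fst b) \<and>
        (\<forall>(u, v)\<in>R. closed_segment (fst u) (fst v) \<inter> convex hull {fst a, fst b, fst c, fst d}
           \<subseteq> {fst a, fst b, fst c, fst d}) \<and>
        Im (cnj (fst b - fst a) * (fst d - fst c)) > 0 \<and>
        crosses_above p q c d \<and> crosses_above c d p' q')"

definition skein_triple ::
  "(real \<Rightarrow> space4) set \<Rightarrow> (real \<Rightarrow> space4) set \<Rightarrow> (real \<Rightarrow> space4) set \<Rightarrow> bool" where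
  "skein_triple Lp Lm L0 \<longleftrightarrow>
     (\<exists>Ep Em E0. skein_diagrams Ep Em E0 \<and>
        has_diagram Lp Ep \<and> has_diagram Lm Em \<and> has_diagram L0 E0)"


section \<open>Unlinks and skein trees\<close>

definition round_unlink :: "nat \<Rightarrow> (real \<Rightarrow> space4) set" where
  "round_unlink r = (\<lambda>k::nat. \<lambda>t. stereo (cis (2 * pi * t) + 3 * of_nat k, 0)) ` {..<r}"

definition unlink :: "(real \<Rightarrow> space4) set \<Rightarrow> bool" where
  "unlink L \<longleftrightarrow> oriented_link L \<and> (\<exists>r\<ge>1. isotopic L (round_unlink r))"

datatype 'l bintree = Leaf (root: 'l) | Node (root: 'l) "'l bintree" "'l bintree"

text \<open>The children of a node are determined up to isotopy only, as \<open>skein_triple\<close> does not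
  distinguish isotopic links.\<close>

fun skein_tree :: "(real \<Rightarrow> space4) set bintree \<Rightarrow> bool" where
  "skein_tree (Leaf L) \<longleftrightarrow> unlink L"
| "skein_tree (Node L T1 T2) \<longleftrightarrow>
     (skein_triple L (root T1) (root T2) \<or> skein_triple (root T1) L (root T2)) \<and>
     skein_tree T1 \<and> skein_tree T2"

fun depth :: "'l bintree \<Rightarrow> nat" where
  "depth (Leaf L) = 0"
| "depth (Node L T1 T2) = Suc (max (depth T1) (depth T2))"

text \<open>The infimum is over a well-ordered set, hence a minimum whenever \<open>L\<close> has a skein tree
  (which is the case for every link), and it is \<open>\<infinity>\<close> otherwise.\<close>

definition skein_tree_depth :: "(real \<Rightarrow> space4) set \<Rightarrow> enat" where
  "skein_tree_depth L = (INF T \<in> {T. skein_tree T \<and> root T = L}. enat (depth T))"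


section \<open>The HOMFLY-PT polynomial\<close>

text \<open>Integral Laurent polynomials in \<open>a\<close> and \<open>z\<close>: the coefficient of \<open>a\<^sup>i z\<^sup>j\<close> is the value at
  \<open>(i, j)\<close>, and the multiplication of \<^typ>\<open>(int \<times> int) \<Rightarrow>\<^sub>0 int\<close> is that of Laurent polynomials.\<close>

type_synonym laurent = "(int \<times> int) \<Rightarrow>\<^sub>0 int"

definition laurent_monom :: "int \<Rightarrow> int \<Rightarrow> laurent" where
  "laurent_monom i j = Poly_Mapping.single (i, j) 1"

text \<open>Unspecified for the zero polynomial, which is not the HOMFLY-PT polynomial of any link.\<close>

definition deg_z :: "laurent \<Rightarrow> int" where
  "deg_z f = Max (snd ` Poly_Mapping.keys f)"

text \<open>The conditions that determine the values of the HOMFLY-PT polynomial on all oriented links.\<close>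

definition homflypt :: "((real \<Rightarrow> space4) set \<Rightarrow> laurent) \<Rightarrow> bool" where
  "homflypt P \<longleftrightarrow>
     (\<forall>L M. oriented_link L \<and> oriented_link M \<and> isotopic L M \<longrightarrow> P L = P M) \<and>
     P (round_unlink 1) = 1 \<and>
     (\<forall>Lp Lm L0. skein_triple Lp Lm L0 \<longrightarrow>
        laurent_monom (-1) 0 * P Lp - laurent_monom 1 0 * P Lm = laurent_monom 0 1 * P L0)"

end

theory Submission
  imports Defs
begin

text \<open>
  In a skein triple, \<open>P(L\<^sub>+) = a\<^sup>2 P(L\<^sub>-) + a z P(L\<^sub>0)\<close>, and similarly for \<open>P(L\<^sub>-)\<close>. So the \<open>z\<close>-degree of a node
  of a skein tree is at most the degree of its first child or one more than the degree of its second
  child. If every unlink has \<open>z\<close>-degree at most \<open>0\<close>, induction on a skein tree bounds the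
  degree of the root by the depth (\<open>skein_tree_bounds\<close>).

  Two facts about the polynomial remain. First, the degree has to be that of a nonzero polynomial.
  Evaluation at \<open>a = 1/2, z = 3/2\<close>, a point of the curve \<open>z = a\<^sup>-\<^sup>1 - a\<close>, turns the skein relation into
  \<open>a\<^sup>-\<^sup>1 x - a y = (a\<^sup>-\<^sup>1 - a) w\<close>, in which the third unknown is \<open>1\<close> as soon as
  two of them are. Hence all unlinks, and then all links with a skein tree, take the value \<open>1\<close> there. Second, the polynomial of the unlink with \<open>r\<close> components is
  \<open>((a\<^sup>-\<^sup>1 - a) / z)\<^sup>r\<^sup>-\<^sup>1\<close>, which needs a skein triple formed by two unlinks with \<open>r\<close> components
  and one with \<open>r + 1\<close> components (\<open>skein_triple_unlink\<close>). Most of the text constructs it.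

  The first component of the crossed diagrams is a figure eight and the smoothing splits it into two
  diamonds \<open>\<bar>x - 3 k\<bar> + \<bar>y\<bar> = 1\<close>; all further components are diamonds. Each of these curves
  consists of the graphs of two functions on one interval of the \<open>x\<close>-axis which agree at its ends only. Such
  a bigon has a parametrization and a polygonal description which are easy to compare, and
  disjointness and regularity of the projection are questions about one real variable (locale
  \<open>bigon\<close>).

  The isotopies are compositions of two elementary kinds. In the first one, every plane \<open>x = const\<close>,
  seen as a complex line, undergoes an affine map \<open>w \<mapsto> A(x) (w - C(x))\<close> with \<open>A(x) \<noteq> 0\<close>; it is an isotopy
  since \<open>A\<close> has a continuous logarithm (\<open>slice_isotopy_exists\<close>). It centres the two points in
  which the figure eight meets the plane and turns the vector between them into the \<open>y\<close>-direction, so that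
  the curve becomes planar, whichever strand is on top. The second kind deforms the \<open>x\<close>- and
  \<open>y\<close>-axes by increasing maps (\<open>space_isotopy_coordinatewise\<close>). As
  \<open>cos\<^sup>2 + sin\<^sup>2 = 1\<close>, a signed square root in both coordinates makes the diamonds round.
\<close>

section \<open>Degree and a special value of Laurent polynomials\<close>

text \<open>The value at \<open>a = 1/2\<close>, \<open>z = 3/2\<close>; here \<open>z = a\<^sup>-\<^sup>1 - a\<close>, the condition under which the skein relation
  admits the constant solution \<open>1\<close>.\<close>

definition special_value :: "laurent \<Rightarrow> real" where
  "special_value f = (\<Sum>(i, j) \<in> Poly_Mapping.keys f. of_int (Poly_Mapping.lookup f (i, j)) * ((1/2) powi i * (3/2) powi j))"

lemma special_value_add: "special_value (f + g) = special_value f + special_value g"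
proof -
  define w :: "int \<times> int \<Rightarrow> int \<Rightarrow> real"
    where "w = (\<lambda>(i, j) c. of_int c * ((1/2) powi i * (3/2) powi j))"
  have special_value_w: "special_value h = (\<Sum>m \<in> Poly_Mapping.keys h. w m (Poly_Mapping.lookup h m))" for h
    unfolding special_value_def w_def by (rule sum.cong) auto
  show ?thesis
    unfolding special_value_w by (rule setsum_keys_plus_distrib) (auto simp: w_def algebra_simps)
qed

lemma special_value_0 [simp]: "special_value 0 = 0"
  by (simp add: special_value_def)

lemma special_value_diff: "special_value (f - g) = special_value f - special_value g"
  using special_value_add[of "f - g" g] by simp

lemma special_value_laurent_monom [simp]: "special_value (laurent_monom i j) = (1/2) powi i * (3/2) powi j"
  by (simp add: special_value_def laurent_monom_def)

lemma laurent_monom_mult: "laurent_monom i j * laurent_monom k l = laurent_monom (i + k) (j + l)"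
  by (simp add: laurent_monom_def mult_single)

lemma laurent_monom_0_0: "laurent_monom 0 0 = 1"
  by (metis laurent_monom_def single_one zero_prod_def)

text \<open>Evaluation is multiplicative. One monomial factor suffices for the skein relation, and then
  additivity reduces the claim to products of two monomials.\<close>

lemma special_value_monom_mult: "special_value (laurent_monom i j * f) = (1/2) powi i * (3/2) powi j * special_value f"
proof (rule frag_induction[where S = UNIV and c = f])
  fix m :: "int \<times> int"
  obtain k l where m: "m = (k, l)" by (cases m)
  have "frag_of m = laurent_monom k l"
    by (simp add: m laurent_monom_def)
  then show "special_value (laurent_monom i j * frag_of m) = (1/2) powi i * (3/2) powi j * special_value (frag_of m)"
    by (simp add: laurent_monom_mult power_int_add)
qed (auto simp: right_diff_distrib special_value_diff algebra_simps)

text \<open>In contrast to \<open>deg_z\<close>, this bound is meaningful for the zero polynomial and is thus stable under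
  cancellation in sums.\<close>

definition deg_z_le :: "laurent \<Rightarrow> int \<Rightarrow> bool" where
  "deg_z_le f n \<longleftrightarrow> (\<forall>m \<in> Poly_Mapping.keys f. snd m \<le> n)"

lemma deg_z_le_mono: "deg_z_le f m \<Longrightarrow> m \<le> n \<Longrightarrow> deg_z_le f n"
  unfolding deg_z_le_def by force

lemma deg_z_le_add: "deg_z_le f n \<Longrightarrow> deg_z_le g n \<Longrightarrow> deg_z_le (f + g) n"
  using keys_add[of f g] unfolding deg_z_le_def by blast

lemma deg_z_le_diff: "deg_z_le f n \<Longrightarrow> deg_z_le g n \<Longrightarrow> deg_z_le (f - g) n"
  using keys_diff[of f g] unfolding deg_z_le_def by blast

lemma deg_z_le_monom_mult: "deg_z_le f n \<Longrightarrow> deg_z_le (laurent_monom i j * f) (j + n)"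
  using keys_mult[of "laurent_monom i j" f] unfolding deg_z_le_def laurent_monom_def by force

lemma deg_z_leI:
  assumes "f \<noteq> 0" "deg_z_le f n"
  shows "deg_z f \<le> n"
proof -
  have "snd ` Poly_Mapping.keys f \<noteq> {}"
    using assms(1) by simp
  then show ?thesis
    using assms(2) unfolding deg_z_def deg_z_le_def by (subst Max_le_iff) auto
qed

lemma skein_relation_solved:
  assumes "laurent_monom (-1) 0 * f - laurent_monom 1 0 * g = laurent_monom 0 1 * h"
  shows "f = laurent_monom 2 0 * g + laurent_monom 1 1 * h"
    and "g = laurent_monom (-2) 0 * f - laurent_monom (-1) 1 * h"
proof -
  have "laurent_monom 1 0 * (laurent_monom (-1) 0 * f - laurent_monom 1 0 * g) = laurent_monom 1 1 * h"
    by (simp add: assms laurent_monom_mult flip: mult.assoc)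
  then show "f = laurent_monom 2 0 * g + laurent_monom 1 1 * h"
    by (simp add: right_diff_distrib laurent_monom_mult laurent_monom_0_0 flip: mult.assoc)
       (simp add: algebra_simps)
  have "laurent_monom (-1) 0 * (laurent_monom (-1) 0 * f - laurent_monom 1 0 * g) = laurent_monom (-1) 1 * h"
    by (simp add: assms laurent_monom_mult flip: mult.assoc)
  then show "g = laurent_monom (-2) 0 * f - laurent_monom (-1) 1 * h"
    by (simp add: right_diff_distrib laurent_monom_mult laurent_monom_0_0 flip: mult.assoc)
       (simp add: algebra_simps)
qed


section \<open>From isotopies of 3-space to ambient isotopies of the 3-sphere\<close>

abbreviation north_pole :: space4 where
  "north_pole \<equiv> (0, 1)"

text \<open>Stereographic projection from \<open>(0, 1)\<close>, the inverse of \<open>stereo\<close>.\<close>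

definition unstereo :: "space4 \<Rightarrow> space3" where
  "unstereo p = (1 / (1 - snd p)) *\<^sub>R fst p"

lemma in_S3_iff: "p \<in> S3 \<longleftrightarrow> (norm (fst p))\<^sup>2 + (snd p)\<^sup>2 = 1"
  by (cases p) (auto simp: norm_Pair)

lemma in_S3_iff_dist: "p \<in> S3 \<longleftrightarrow> (norm (fst p))\<^sup>2 = (1 - snd p) * (1 + snd p)"
  unfolding in_S3_iff by (auto simp: algebra_simps power2_eq_square)

lemma snd_less_1:
  assumes "p \<in> S3" "p \<noteq> north_pole"
  shows "snd p < 1"
proof (rule ccontr)
  assume "\<not> snd p < 1"
  then have "(snd p)\<^sup>2 \<ge> 1"
    using one_le_power[of "snd p" 2] by simp
  then have "(norm (fst p))\<^sup>2 = 0 \<and> (snd p)\<^sup>2 = 1"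
    using assms(1) zero_le_power2[of "norm (fst p)"] unfolding in_S3_iff by linarith
  then have "p = north_pole"
    using \<open>\<not> snd p < 1\<close> by (auto simp: prod_eq_iff power2_eq_1_iff)
  with assms(2) show False by simp
qed

lemma stereo_in_S3: "stereo x \<in> S3 - {north_pole}"
proof -
  define n where "n = (norm x)\<^sup>2"
  have n: "n \<ge> 0" by (simp add: n_def)
  have "(norm (fst (stereo x)))\<^sup>2 + (snd (stereo x))\<^sup>2 = 4 * n / (n + 1)\<^sup>2 + (n - 1)\<^sup>2 / (n + 1)\<^sup>2"
    by (simp add: stereo_def power_mult_distrib power_divide flip: n_def)
  also have "\<dots> = 1"
    using n by (simp add: field_simps) (simp add: power2_eq_square algebra_simps)
  finally show ?thesis
    using n unfolding Diff_iff in_S3_iff by (simp add: stereo_def flip: n_def)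
qed

lemma unstereo_stereo [simp]: "unstereo (stereo x) = x"
proof -
  define n where "n = (norm x)\<^sup>2"
  have n: "n \<ge> 0" by (simp add: n_def)
  then have "1 / (1 - (n - 1) / (n + 1)) * (2 / (n + 1)) = 1"
    by (simp add: field_simps)
  then show ?thesis
    by (simp add: unstereo_def stereo_def flip: n_def)
qed

lemma stereo_unstereo:
  assumes "p \<in> S3" "p \<noteq> north_pole"
  shows "stereo (unstereo p) = p"
proof -
  have s: "snd p < 1" by (rule snd_less_1[OF assms])
  define s where "s = snd p"
  have "(norm (unstereo p))\<^sup>2 = (1 - s) * (1 + s) / (1 - s)\<^sup>2"
    using assms(1) s unfolding in_S3_iff_dist
    by (simp add: unstereo_def power_divide s_def)
  also have "\<dots> = (1 + s) / (1 - s)"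
    using s by (simp add: s_def power2_eq_square)
  finally have n: "(norm (unstereo p))\<^sup>2 = (1 + s) / (1 - s)" .
  have "(norm (unstereo p))\<^sup>2 + 1 = 2 / (1 - s)" "(norm (unstereo p))\<^sup>2 - 1 = 2 * s / (1 - s)"
    using s unfolding n by (simp_all add: s_def field_simps)
  then show ?thesis
    using s by (auto simp: stereo_def prod_eq_iff s_def unstereo_def)
qed

lemma inj_stereo: "inj stereo"
  by (rule inj_on_inverseI) (rule unstereo_stereo)

lemma continuous_on_stereo: "continuous_on S stereo"
  unfolding stereo_def
  by (intro continuous_intros) (metis add_nonneg_pos zero_le_power2 zero_less_one order_less_irrefl)+

lemma continuous_on_unstereo: "continuous_on (S3 - {north_pole}) unstereo"
  unfolding unstereo_def by (intro continuous_intros) (use snd_less_1 in fastforce)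

text \<open>This is where continuity at the pole comes from: points of 3-space are close to the pole exactly
  when their norm is large.\<close>

lemma dist_stereo_north_pole: "(dist (stereo x) north_pole)\<^sup>2 = 4 / ((norm x)\<^sup>2 + 1)"
proof -
  define n where "n = (norm x)\<^sup>2"
  have n: "n \<ge> 0" by (simp add: n_def)
  have *: "(n - 1) / (n + 1) - 1 = - 2 / (n + 1)"
    using n by (simp add: field_simps)
  have "(dist (stereo x) north_pole)\<^sup>2 = 4 * n / (n + 1)\<^sup>2 + (- 2 / (n + 1))\<^sup>2"
    by (simp add: stereo_def dist_norm norm_Pair power_mult_distrib power_divide add_nonneg_nonneg n * flip: n_def)
  also have "\<dots> = 4 / (n + 1)"
    using n by (simp add: field_simps) (simp add: power2_eq_square algebra_simps)
  finally show ?thesis by (simp add: n_def)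
qed

text \<open>The last condition makes the maps proper, uniformly in the time, so that they extend continuously
  to the point at infinity. Linear growth, rather than bounded displacement, is allowed because
  rotations and scalings of planes are needed.\<close>

definition space_isotopy :: "(real \<Rightarrow> space3 \<Rightarrow> space3) \<Rightarrow> bool" where
  "space_isotopy h \<longleftrightarrow>
     continuous_on ({0..1} \<times> UNIV) (\<lambda>(t, x). h t x) \<and>
     (\<forall>t\<in>{0..1}. bij (h t)) \<and> (\<forall>x. h 0 x = x) \<and>
     (\<exists>c>0. \<exists>C. \<forall>t\<in>{0..1}. \<forall>x. norm x \<le> c * norm (h t x) + C)"

text \<open>Composing at each time avoids the concatenation of paths of homeomorphisms.\<close>

lemma space_isotopy_compose:
  assumes "space_isotopy h" "space_isotopy k"
  shows "space_isotopy (\<lambda>t. k t \<circ> h t)"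
proof -
  obtain c C where h: "continuous_on ({0..1} \<times> UNIV) (\<lambda>(t, x). h t x)"
    "\<And>t. t \<in> {0..1} \<Longrightarrow> bij (h t)" "\<And>x. h 0 x = x" "c > 0"
    "\<And>t x. t \<in> {0..1} \<Longrightarrow> norm x \<le> c * norm (h t x) + C"
    using assms(1) unfolding space_isotopy_def by metis
  obtain d D where k: "continuous_on ({0..1} \<times> UNIV) (\<lambda>(t, x). k t x)"
    "\<And>t. t \<in> {0..1} \<Longrightarrow> bij (k t)" "\<And>x. k 0 x = x" "d > 0"
    "\<And>t x. t \<in> {0..1} \<Longrightarrow> norm x \<le> d * norm (k t x) + D"
    using assms(2) unfolding space_isotopy_def by metis
  have h': "continuous_on ({0..1} \<times> UNIV) (\<lambda>p. h (fst p) (snd p))"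
    using h(1) by (simp add: case_prod_unfold)
  have "continuous_on ({0..1} \<times> UNIV) ((\<lambda>(t, x). k t x) \<circ> (\<lambda>p. (fst p, h (fst p) (snd p))))"
    by (intro continuous_on_compose continuous_intros h' continuous_on_subset[OF k(1)]) auto
  then have "continuous_on ({0..1} \<times> UNIV) (\<lambda>(t, x). (k t \<circ> h t) x)"
    by (simp add: o_def case_prod_unfold)
  moreover have "norm x \<le> (c * d) * norm ((k t \<circ> h t) x) + (c * D + C)" if "t \<in> {0..1}" for t x
  proof -
    have "norm x \<le> c * norm (h t x) + C" by (rule h(5)[OF that])
    also have "\<dots> \<le> c * (d * norm (k t (h t x)) + D) + C"
      using k(5)[OF that, of "h t x"] h(4) by (intro add_right_mono mult_left_mono) auto
    finally show ?thesis by (simp add: algebra_simps)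
  qed
  moreover have "c * d > 0" using h(4) k(4) by simp
  moreover have "bij (k t \<circ> h t)" if "t \<in> {0..1}" for t
    using h(2) k(2) that by (blast intro: bij_comp)
  moreover have "(k 0 \<circ> h 0) x = x" for x
    by (simp only: o_apply h(3) k(3))
  ultimately show ?thesis
    unfolding space_isotopy_def by blast
qed

lemma space_isotopy_continuous:
  assumes "space_isotopy h"
  shows "continuous_on UNIV (h 1)"
proof -
  have "continuous_on UNIV ((\<lambda>(t, x). h t x) \<circ> (\<lambda>x. (1, x)))"
    by (rule continuous_on_compose)
       (use assms in \<open>auto simp: space_isotopy_def intro!: continuous_intros elim: continuous_on_subset\<close>)
  then show ?thesis by (simp add: o_def)
qed

lemma space_isotopy_inj: "space_isotopy h \<Longrightarrow> inj (h 1)"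
  by (auto simp: space_isotopy_def bij_def)

definition sphere_map :: "(space3 \<Rightarrow> space3) \<Rightarrow> space4 \<Rightarrow> space4" where
  "sphere_map f p = (if p = north_pole then p else stereo (f (unstereo p)))"

lemma sphere_map_stereo [simp]: "sphere_map f (stereo x) = stereo (f x)"
  using stereo_in_S3[of x] by (simp add: sphere_map_def)

lemma bij_betw_sphere_map:
  assumes "bij f"
  shows "bij_betw (sphere_map f) S3 S3"
proof (rule bij_betwI[where g = "sphere_map (inv f)"])
  have in_S3: "sphere_map g p \<in> S3" if "p \<in> S3" for g p
    using that stereo_in_S3 by (auto simp: sphere_map_def)
  show "sphere_map f \<in> S3 \<rightarrow> S3" "sphere_map (inv f) \<in> S3 \<rightarrow> S3"
    using in_S3 by blast+
  have north: "sphere_map g north_pole = north_pole" for g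
    by (simp add: sphere_map_def)
  have inverse: "sphere_map g' (sphere_map g p) = p" if "p \<in> S3" "\<And>x. g' (g x) = x" for g g' p
  proof (cases "p = north_pole")
    case False
    then have "p = stereo (unstereo p)"
      using that(1) by (simp add: stereo_unstereo)
    then show ?thesis
      using that(2) by (metis sphere_map_stereo)
  qed (simp add: north)
  show "sphere_map (inv f) (sphere_map f p) = p" if "p \<in> S3" for p
    using assms that by (intro inverse) (auto simp: bij_def)
  show "sphere_map f (sphere_map (inv f) p) = p" if "p \<in> S3" for p
    using assms that by (intro inverse) (auto simp: bij_def surj_f_inv_f)
qed

text \<open>Away from the pole the map is a composition of continuous ones. Near the pole, a point has
  large norm in 3-space, hence so has its image at every time by the uniform growth condition, and so
  the image is close to the pole.\<close>

lemma continuous_on_sphere_map: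
  assumes "space_isotopy h"
  shows "continuous_on ({0..1} \<times> S3) (\<lambda>(t, p). sphere_map (h t) p)"
proof -
  let ?F = "\<lambda>(t, p). sphere_map (h t) p"
  obtain c C where h: "continuous_on ({0..1} \<times> UNIV) (\<lambda>(t, x). h t x)" "c > 0"
    and bound: "\<And>t x. t \<in> {0..1} \<Longrightarrow> norm x \<le> c * norm (h t x) + C"
    using assms unfolding space_isotopy_def by metis
  let ?U = "{0..1::real} \<times> (S3 - {north_pole})"
  have "continuous_on ?U (stereo \<circ> ((\<lambda>(t, x). h t x) \<circ> (\<lambda>p. (fst p, unstereo (snd p)))))"
    by (intro continuous_on_compose continuous_intros continuous_on_stereo
        continuous_on_compose2[OF continuous_on_unstereo, of _ snd] continuous_on_subset[OF h(1)]) auto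
  then have "continuous_on ?U ?F"
    by (rule continuous_on_eq) (simp add: sphere_map_def mem_Times_iff case_prod_unfold del: split_paired_All)
  moreover have "at q within ?U = at q within {0..1::real} \<times> S3" if "q \<in> ?U" for q
    by (rule at_within_nhd[where S = "UNIV \<times> - {north_pole}"]) (use that in \<open>auto intro: open_Times\<close>)
  ultimately have away: "continuous (at q within {0..1::real} \<times> S3) ?F" if "q \<in> ?U" for q
    using that unfolding continuous_on_eq_continuous_within by metis
  have pole: "continuous (at (t0, north_pole) within {0..1} \<times> S3) ?F" for t0 :: real
    unfolding continuous_within_eps_delta
  proof (intro allI impI)
    fix e :: real
    assume "e > 0"
    define M where "M = 2 / e"
    have "M > 0" using \<open>e > 0\<close> by (simp add: M_def)
    \<comment> \<open>Images of norm more than \<open>M\<close> are within \<open>e\<close> of the pole, and points of norm more than \<open>N\<close> have such images.\<close>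
    define N where "N = c * M + \<bar>C\<bar> + 1"
    have "N > 0" using \<open>M > 0\<close> h(2) by (simp add: N_def add_nonneg_pos)
    define d where "d = 2 / sqrt (N\<^sup>2 + 1)"
    have "d > 0" by (simp add: d_def add_nonneg_pos)
    have "dist (?F q) (?F (t0, north_pole)) < e"
      if q: "q \<in> {0..1} \<times> S3" and near: "dist q (t0, north_pole) < d" for q
    proof -
      obtain t p where tp: "q = (t, p)" "t \<in> {0..1}" "p \<in> S3" using q by auto
      show ?thesis
      proof (cases "p = north_pole")
        case True
        then show ?thesis using tp \<open>e > 0\<close> by (simp add: sphere_map_def)
      next
        case False
        define x where "x = unstereo p"
        have x: "stereo x = p" using tp False by (simp add: x_def stereo_unstereo)
        have "dist p north_pole < d"
          using near dist_snd_le[of q "(t0, north_pole)"] by (simp add: tp)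
        then have "(dist p north_pole)\<^sup>2 < d\<^sup>2"
          by (intro power_strict_mono) auto
        then have "4 / ((norm x)\<^sup>2 + 1) < 4 / (N\<^sup>2 + 1)"
          unfolding x[symmetric] dist_stereo_north_pole by (simp add: d_def power_divide add_nonneg_nonneg)
        moreover have "0 < (norm x)\<^sup>2 + 1" "0 < N\<^sup>2 + 1"
          by (simp_all add: add_nonneg_pos)
        ultimately have "N\<^sup>2 < (norm x)\<^sup>2"
          by (simp add: field_simps)
        then have "N < norm x"
          using power_less_imp_less_base by fastforce
        then have "c * M < c * norm (h t x)"
          using bound[OF tp(2), of x] by (simp add: N_def)
        then have "M < norm (h t x)"
          using h(2) by simp
        then have "M\<^sup>2 < (norm (h t x))\<^sup>2"
          using \<open>M > 0\<close> by (intro power_strict_mono) auto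
        then have "4 / ((norm (h t x))\<^sup>2 + 1) < 4 / M\<^sup>2"
          using \<open>M > 0\<close> by (intro divide_strict_left_mono) (auto simp: add_nonneg_pos)
        also have "4 / M\<^sup>2 = e\<^sup>2"
          using \<open>e > 0\<close> by (simp add: M_def power_divide)
        finally have "(dist (stereo (h t x)) north_pole)\<^sup>2 < e\<^sup>2"
          by (simp add: dist_stereo_north_pole)
        then have "dist (stereo (h t x)) north_pole < e"
          using power_less_imp_less_base \<open>e > 0\<close> by (metis less_imp_le)
        then show ?thesis
          by (simp add: tp flip: x) (simp add: sphere_map_def)
      qed
    qed
    then show "\<exists>d>0. \<forall>q\<in>{0..1} \<times> S3. dist q (t0, north_pole) < d \<longrightarrow> dist (?F q) (?F (t0, north_pole)) < e"
      using \<open>d > 0\<close> by blast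
  qed
  show ?thesis
    unfolding continuous_on_eq_continuous_within
  proof
    fix q :: "real \<times> space4"
    assume "q \<in> {0..1} \<times> S3"
    then show "continuous (at q within {0..1} \<times> S3) ?F"
      using away[of q] pole[of "fst q"] by (cases q) fastforce
  qed
qed

lemma ambient_isotopy_sphere_map:
  assumes "space_isotopy h"
  shows "ambient_isotopy (\<lambda>t. sphere_map (h t))"
  unfolding ambient_isotopy_def
proof (intro conjI ballI)
  show "continuous_on ({0..1} \<times> S3) (\<lambda>(t, x). sphere_map (h t) x)"
    by (rule continuous_on_sphere_map[OF assms])
next
  fix t :: real
  assume t: "t \<in> {0..1}"
  have "continuous_on S3 ((\<lambda>(t, p). sphere_map (h t) p) \<circ> (\<lambda>p. (t, p)))"
    using t by (intro continuous_on_compose continuous_intros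
        continuous_on_subset[OF continuous_on_sphere_map[OF assms]]) auto
  then have "continuous_on S3 (sphere_map (h t))"
    by (simp add: o_def)
  moreover have "bij_betw (sphere_map (h t)) S3 S3"
    using assms t by (intro bij_betw_sphere_map) (auto simp: space_isotopy_def)
  ultimately show "\<exists>G. homeomorphism S3 S3 (sphere_map (h t)) G"
    by (metis homeomorphism_compact compact_sphere bij_betw_def)
next
  fix p assume "p \<in> S3"
  moreover have "h 0 (unstereo p) = unstereo p"
    using assms unfolding space_isotopy_def by blast
  ultimately show "sphere_map (h 0) p = p"
    by (simp add: sphere_map_def stereo_unstereo del: mem_sphere_0)
qed

lemma same_oriented_circle_refl: "same_oriented_circle \<gamma> \<gamma>"
  unfolding same_oriented_circle_def by (rule exI[of _ id]) (auto simp: strict_mono_def)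

lemma isotopic_space_isotopy:
  assumes "space_isotopy h"
  shows "isotopic ((\<lambda>\<gamma>. stereo \<circ> \<gamma>) ` \<Gamma>) ((\<lambda>\<gamma>. stereo \<circ> (h 1 \<circ> \<gamma>)) ` \<Gamma>)"
proof -
  have "sphere_map (h 1) \<circ> (stereo \<circ> \<gamma>) = stereo \<circ> (h 1 \<circ> \<gamma>)" for \<gamma> :: "real \<Rightarrow> space3"
    by (simp add: fun_eq_iff)
  then show ?thesis
    unfolding isotopic_def using ambient_isotopy_sphere_map[OF assms] same_oriented_circle_refl
    by (intro exI[of _ "\<lambda>t. sphere_map (h t)"]) auto
qed

lemma oriented_circles_image:
  assumes "oriented_circles \<Gamma>" "continuous_on UNIV f" "inj f"
  shows "oriented_circles ((\<lambda>\<gamma>. f \<circ> \<gamma>) ` \<Gamma>)"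
  unfolding oriented_circles_def
proof (intro conjI ballI)
  show "finite ((\<lambda>\<gamma>. f \<circ> \<gamma>) ` \<Gamma>)" "(\<lambda>\<gamma>. f \<circ> \<gamma>) ` \<Gamma> \<noteq> {}"
    using assms(1) by (auto simp: oriented_circles_def)
next
  fix \<delta> assume "\<delta> \<in> (\<lambda>\<gamma>. f \<circ> \<gamma>) ` \<Gamma>"
  then obtain \<gamma> where \<gamma>: "\<delta> = f \<circ> \<gamma>" "embedded_circle \<gamma>"
    using assms(1) by (auto simp: oriented_circles_def)
  then show "embedded_circle \<delta>"
    unfolding embedded_circle_def \<gamma>(1)
    using assms(2,3) by (auto simp: inj_eq intro: continuous_on_compose2[of UNIV f])
next
  have "disjnt (range (f \<circ> \<gamma>)) (range (f \<circ> \<delta>))" if "disjnt (range \<gamma>) (range \<delta>)" for \<gamma> \<delta> :: "real \<Rightarrow> 'a"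
    using that assms(3) by (auto simp: disjnt_def dest: injD)
  then show "pairwise (\<lambda>\<gamma> \<delta>. disjnt (range \<gamma>) (range \<delta>)) ((\<lambda>\<gamma>. f \<circ> \<gamma>) ` \<Gamma>)"
    using assms(1) unfolding oriented_circles_def pairwise_def by (simp add: ball_simps) metis
qed

text \<open>An isotopy of 3-space that carries the traversing circles to a link exhibits the polygon as a
  diagram of that link, and proves on the way that the link is tame.\<close>

lemma has_diagram_space_isotopy:
  assumes "link_diagram E" "traverses \<Gamma> E" "space_isotopy h"
  shows "has_diagram ((\<lambda>\<gamma>. stereo \<circ> (h 1 \<circ> \<gamma>)) ` \<Gamma>) E"
proof -
  let ?L = "(\<lambda>\<gamma>. stereo \<circ> (h 1 \<circ> \<gamma>)) ` \<Gamma>"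
  have iso: "isotopic_to_polygonal ?L E"
    unfolding isotopic_to_polygonal_def using assms(2) isotopic_space_isotopy[OF assms(3)] by blast
  have "oriented_circles ((\<lambda>\<gamma>. (stereo \<circ> h 1) \<circ> \<gamma>) ` \<Gamma>)"
    using assms(2,3) space_isotopy_continuous space_isotopy_inj
    by (intro oriented_circles_image)
       (auto simp: traverses_def intro!: continuous_on_compose2[OF continuous_on_stereo, of _ "h 1"] inj_compose inj_stereo)
  then have "oriented_circles ?L"
    by (simp add: o_assoc)
  moreover have "range \<delta> \<subseteq> S3" if \<delta>: "\<delta> \<in> ?L" for \<delta>
  proof -
    obtain \<gamma> where "\<delta> = stereo \<circ> (h 1 \<circ> \<gamma>)"
      using \<delta> by blast
    then have "\<delta> x \<in> S3" for x
      using stereo_in_S3[of "h 1 (\<gamma> x)"] by simp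
    then show ?thesis by blast
  qed
  ultimately have "oriented_link ?L"
    unfolding oriented_link_def using iso assms(1) by (auto simp: link_diagram_def)
  then show ?thesis
    unfolding has_diagram_def using assms(1) iso by blast
qed

section \<open>Elementary isotopies of 3-space\<close>

text \<open>3-space as a family of complex planes: \<open>w\<close> lies in the plane orthogonal to the \<open>x\<close>-axis at \<open>x\<close>,
  its real part is the \<open>y\<close>-coordinate of the diagram and its imaginary part is the height.\<close>

definition pt :: "real \<Rightarrow> complex \<Rightarrow> space3" where
  "pt x w = (Complex x (Re w), Im w)"

definition xcoord :: "space3 \<Rightarrow> real" where
  "xcoord p = Re (fst p)"

definition wcoord :: "space3 \<Rightarrow> complex" where
  "wcoord p = Complex (Im (fst p)) (snd p)"

lemma pt_simps [simp]:
  "xcoord (pt x w) = x" "wcoord (pt x w) = w" "pt (xcoord p) (wcoord p) = p"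
  by (simp_all add: pt_def xcoord_def wcoord_def)

lemma pt_eq_iff [simp]: "pt x w = pt x' w' \<longleftrightarrow> x = x' \<and> w = w'"
  by (metis pt_simps(1,2))

lemma fst_pt: "fst (pt x w) = Complex x (Re w)"
  by (simp add: pt_def)

lemma continuous_on_Complex_intro [continuous_intros]:
  "continuous_on S f \<Longrightarrow> continuous_on S g \<Longrightarrow> continuous_on S (\<lambda>x. Complex (f x) (g x))"
  unfolding Complex_eq by (intro continuous_intros)

lemma continuous_on_pt [continuous_intros]:
  "continuous_on S f \<Longrightarrow> continuous_on S g \<Longrightarrow> continuous_on S (\<lambda>x. pt (f x) (g x))"
  unfolding pt_def by (intro continuous_intros)

lemma continuous_on_xcoord [continuous_intros]:
  "continuous_on S f \<Longrightarrow> continuous_on S (\<lambda>x. xcoord (f x))"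
  unfolding xcoord_def by (intro continuous_intros)

lemma continuous_on_wcoord [continuous_intros]:
  "continuous_on S f \<Longrightarrow> continuous_on S (\<lambda>x. wcoord (f x))"
  unfolding wcoord_def by (intro continuous_intros)

lemma norm_pt: "norm (pt x w) = sqrt (x\<^sup>2 + (norm w)\<^sup>2)"
  by (simp add: pt_def norm_Pair cmod_power2)

lemma norm_pt_bounds: "\<bar>x\<bar> \<le> norm (pt x w)" "norm w \<le> norm (pt x w)" "norm (pt x w) \<le> \<bar>x\<bar> + norm w"
  using sqrt_sum_squares_le_sum_abs[of x "norm w"]
  by (simp_all add: norm_pt real_le_rsqrt)

text \<open>Each time map preserves the planes \<open>x = const\<close> and acts on them by an invertible affine map. Bounds
  on \<open>logA\<close> and \<open>C\<close> bound the inverse of this map linearly.\<close>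

lemma space_isotopy_slicewise:
  fixes logA C :: "real \<Rightarrow> complex"
  assumes cont: "continuous_on UNIV logA" "continuous_on UNIV C"
    and bounded: "\<And>x. norm (logA x) \<le> B" "\<And>x. norm (C x) \<le> B"
  shows "space_isotopy (\<lambda>t p. pt (xcoord p) (exp (of_real t * logA (xcoord p)) * (wcoord p - of_real t * C (xcoord p))))"
    (is "space_isotopy ?h")
  unfolding space_isotopy_def
proof (intro conjI ballI allI)
  show "continuous_on ({0..1} \<times> UNIV) (\<lambda>(t, p). ?h t p)"
    unfolding case_prod_unfold
    by (intro continuous_intros continuous_on_compose2[OF cont(1)] continuous_on_compose2[OF cont(2)]) auto
next
  fix t :: real
  define k where "k p = pt (xcoord p) (exp (- (of_real t * logA (xcoord p))) * wcoord p + of_real t * C (xcoord p))" for p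
  show "bij (?h t)"
    by (rule o_bij[of k]) (simp_all add: fun_eq_iff k_def exp_minus flip: mult.assoc del: split_paired_All)
next
  fix p :: space3
  show "?h 0 p = p" by simp
next
  have B: "B \<ge> 0" using bounded(1) norm_ge_zero order_trans by blast
  have "norm p \<le> (1 + exp B) * norm (?h t p) + B" if t: "t \<in> {0..1}" for t p
  proof -
    define x w where "x = xcoord p" and "w = wcoord p"
    define m where "m = exp (of_real t * logA x) * (w - of_real t * C x)"
    have p: "p = pt x w" by (simp add: x_def w_def)
    have small: "norm (of_real t * z) \<le> B" if "norm z \<le> B" for z :: complex
      using t that mult_mono[of t 1 "norm z" B] by (simp add: norm_mult)
    have "w = exp (- (of_real t * logA x)) * m + of_real t * C x"
      by (simp add: m_def exp_minus flip: mult.assoc)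
    then have "norm w \<le> norm (exp (- (of_real t * logA x))) * norm m + norm (of_real t * C x)"
      by (metis norm_mult norm_triangle_ineq)
    also have "norm (exp (- (of_real t * logA x))) \<le> exp B"
      using norm_exp[of "- (of_real t * logA x)"] small[OF bounded(1)[of x]]
      by (smt (verit) exp_le_cancel_iff norm_minus_cancel)
    also have "norm (of_real t * C x) \<le> B"
      by (intro small bounded)
    finally have "norm w \<le> exp B * norm m + B"
      by (simp add: mult_right_mono)
    moreover have "\<bar>x\<bar> \<le> norm (pt x m)" "exp B * norm m \<le> exp B * norm (pt x m)"
      by (auto intro: mult_left_mono norm_pt_bounds)
    ultimately have "norm p \<le> (1 + exp B) * norm (pt x m) + B"
      unfolding p ring_distribs using norm_pt_bounds(3)[of x w] by linarith
    then show ?thesis by (simp add: x_def w_def m_def)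
  qed
  then show "\<exists>c>0. \<exists>D. \<forall>t\<in>{0..1}. \<forall>p. norm p \<le> c * norm (?h t p) + D"
    using B by (intro exI[of _ "1 + exp B"] conjI exI[of _ B]) (auto simp: add_pos_pos)
qed

text \<open>An interval is contractible, so \<open>A\<close> has a continuous logarithm there. Both the logarithm and \<open>C\<close> are
  extended by constants beyond the interval and then cut off within distance \<open>1\<close>; this is possible
  for a logarithm, whereas \<open>A\<close> itself cannot always be interpolated linearly with \<open>1\<close> without a zero.\<close>

lemma slice_isotopy_exists:
  fixes A C :: "real \<Rightarrow> complex"
  assumes "l \<le> r" "continuous_on {l..r} A" "continuous_on {l..r} C" "\<And>x. x \<in> {l..r} \<Longrightarrow> A x \<noteq> 0"
  obtains h where "space_isotopy h"
    "\<And>x w. x \<in> {l..r} \<Longrightarrow> h 1 (pt x w) = pt x (A x * (w - C x))"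
    "\<And>x w. x \<le> l - 1 \<or> r + 1 \<le> x \<Longrightarrow> h 1 (pt x w) = pt x w"
proof -
  obtain g where g: "continuous_on {l..r} g" "\<And>x. x \<in> {l..r} \<Longrightarrow> A x = exp (g x)"
    using continuous_logarithm_on_contractible[of "{l..r}" A] assms(2,4) convex_imp_contractible
    by (metis convex_real_interval(5))
  define clip where "clip x = max l (min r x)" for x
  define cut where "cut x = max 0 (min 1 (min (x - (l - 1)) (r + 1 - x)))" for x
  have clip: "clip x \<in> {l..r}" "x \<in> {l..r} \<Longrightarrow> clip x = x" for x
    using assms(1) by (auto simp: clip_def)
  have cut: "0 \<le> cut x" "cut x \<le> 1" "x \<in> {l..r} \<Longrightarrow> cut x = 1" "x \<le> l - 1 \<or> r + 1 \<le> x \<Longrightarrow> cut x = 0" for x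
    by (auto simp: cut_def)
  define extend where "extend f x = of_real (cut x) * f (clip x)" for f :: "real \<Rightarrow> complex" and x
  have continuous_extend: "continuous_on UNIV (extend f)" if "continuous_on {l..r} f" for f
  proof -
    have "continuous_on UNIV clip" "continuous_on UNIV cut"
      unfolding clip_def cut_def by (intro continuous_intros)+
    moreover have "continuous_on UNIV (\<lambda>x. f (clip x))"
      by (rule continuous_on_compose2[OF that \<open>continuous_on UNIV clip\<close>]) (use clip(1) in auto)
    ultimately show ?thesis
      unfolding extend_def by (intro continuous_intros)
  qed
  have bounded_extend: "\<exists>B. \<forall>x. norm (extend f x) \<le> B" if f: "continuous_on {l..r} f" for f
  proof -
    have "bounded (f ` {l..r})"
      using f by (intro compact_imp_bounded compact_continuous_image) auto
    then obtain B where B: "\<And>x. x \<in> {l..r} \<Longrightarrow> norm (f x) \<le> B"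
      unfolding bounded_iff by blast
    have "norm (extend f x) \<le> 1 * B" for x
      unfolding extend_def norm_mult using B[OF clip(1)[of x]] cut[of x] by (intro mult_mono) auto
    then show ?thesis by auto
  qed
  obtain B1 B2 where "\<And>x. norm (extend g x) \<le> B1" "\<And>x. norm (extend C x) \<le> B2"
    using bounded_extend g(1) assms(3) by metis
  then have B: "\<And>x. norm (extend g x) \<le> max B1 B2" "\<And>x. norm (extend C x) \<le> max B1 B2"
    by (auto simp: le_max_iff_disj)
  let ?h = "\<lambda>t p. pt (xcoord p) (exp (of_real t * extend g (xcoord p)) * (wcoord p - of_real t * extend C (xcoord p)))"
  have "space_isotopy ?h"
    by (rule space_isotopy_slicewise[OF _ _ B]) (auto intro: continuous_extend g(1) assms(3))
  moreover have "?h 1 (pt x w) = pt x (A x * (w - C x))" if "x \<in> {l..r}" for x w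
    using clip(2)[OF that] cut(3)[OF that] g(2)[OF that] by (simp add: extend_def)
  moreover have "?h 1 (pt x w) = pt x w" if "x \<le> l - 1 \<or> r + 1 \<le> x" for x w
    using cut(4)[OF that] by (simp add: extend_def)
  ultimately show thesis using that[of ?h] by blast
qed

text \<open>Bounded displacement makes an increasing continuous map onto, and it is inherited by the
  interpolations with the identity.\<close>

definition line_map :: "(real \<Rightarrow> real) \<Rightarrow> real \<Rightarrow> bool" where
  "line_map f B \<longleftrightarrow> continuous_on UNIV f \<and> strict_mono f \<and> (\<forall>x. \<bar>f x - x\<bar> \<le> B)"

lemma bij_line_map:
  assumes "line_map f B"
  shows "bij f"
proof -
  have B: "\<bar>f x - x\<bar> \<le> B" for x using assms by (simp add: line_map_def)
  have "\<exists>x. f x = y" for y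
  proof -
    have "f (y - B) \<le> y" "y \<le> f (y + B)" "y - B \<le> y + B"
      using B[of "y - B"] B[of "y + B"] by linarith+
    then show ?thesis
      using IVT'[of f "y - B" y "y + B"] assms continuous_on_subset
      unfolding line_map_def by blast
  qed
  then have "surj f"
    by (metis surj_def)
  moreover have "inj f"
    using assms by (simp add: line_map_def strict_mono_imp_inj_on)
  ultimately show ?thesis by (rule bijI[rotated])
qed

lemma line_map_interpolate:
  assumes f: "line_map f B" and t: "t \<in> {0..1}"
  shows "line_map (\<lambda>x. (1 - t) * x + t * f x) B"
  unfolding line_map_def
proof (intro conjI allI)
  show "continuous_on UNIV (\<lambda>x. (1 - t) * x + t * f x)"
    using f unfolding line_map_def by (intro continuous_intros) auto
  show "strict_mono (\<lambda>x. (1 - t) * x + t * f x)"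
  proof (rule strict_monoI)
    fix x y :: real
    assume "x < y"
    then have "f x < f y"
      using f by (simp add: line_map_def strict_mono_def)
    show "(1 - t) * x + t * f x < (1 - t) * y + t * f y"
    proof (cases "t = 0")
      case False
      then have "t * f x < t * f y" "(1 - t) * x \<le> (1 - t) * y"
        using t \<open>f x < f y\<close> \<open>x < y\<close> by (auto intro: mult_left_mono)
      then show ?thesis by linarith
    qed (use \<open>x < y\<close> in simp)
  qed
  fix x
  have "\<bar>t * (f x - x)\<bar> \<le> 1 * B"
    unfolding abs_mult using t f by (intro mult_mono) (auto simp: line_map_def)
  then show "\<bar>(1 - t) * x + t * f x - x\<bar> \<le> B"
    by (simp add: algebra_simps)
qed

lemma space_isotopy_coordinatewise:
  assumes f: "line_map f B" and g: "line_map g D"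
  shows "space_isotopy (\<lambda>t p. (Complex ((1 - t) * Re (fst p) + t * f (Re (fst p)))
                                       ((1 - t) * Im (fst p) + t * g (Im (fst p))), snd p))"
    (is "space_isotopy ?h")
  unfolding space_isotopy_def
proof (intro conjI ballI allI)
  have cont: "continuous_on UNIV f" "continuous_on UNIV g"
    using f g by (simp_all add: line_map_def)
  show "continuous_on ({0..1} \<times> UNIV) (\<lambda>(t, p). ?h t p)"
    unfolding case_prod_unfold
    by (intro continuous_intros continuous_on_compose2[OF cont(1)] continuous_on_compose2[OF cont(2)]) auto
next
  fix t :: real
  assume t: "t \<in> {0..1}"
  define F G where "F = (\<lambda>x. (1 - t) * x + t * f x)" and "G = (\<lambda>x. (1 - t) * x + t * g x)"
  have "bij F" "bij G"
    using line_map_interpolate[OF f t] line_map_interpolate[OF g t] bij_line_map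
    unfolding F_def G_def by blast+
  then obtain F' G' where inv: "\<And>x. F' (F x) = x" "\<And>x. F (F' x) = x" "\<And>x. G' (G x) = x" "\<And>x. G (G' x) = x"
    unfolding bij_iff by metis
  have "bij (\<lambda>p :: space3. (Complex (F (Re (fst p))) (G (Im (fst p))), snd p))"
    by (rule o_bij[of "\<lambda>p. (Complex (F' (Re (fst p))) (G' (Im (fst p))), snd p)"])
       (simp_all add: fun_eq_iff inv)
  then show "bij (?h t)"
    by (simp add: F_def G_def)
next
  fix p :: space3
  show "?h 0 p = p" by (simp add: prod_eq_iff)
next
  have "norm p \<le> 1 * norm (?h t p) + (B + D)" if t: "t \<in> {0..1}" for t p
  proof -
    let ?f = "\<lambda>x. (1 - t) * x + t * f x" and ?g = "\<lambda>x. (1 - t) * x + t * g x"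
    let ?x = "Re (fst p)" and ?y = "Im (fst p)"
    have d: "p - ?h t p = (Complex (?x - ?f ?x) (?y - ?g ?y), 0)"
      by (simp add: prod_eq_iff complex_eq_iff)
    have "norm (p - ?h t p) \<le> \<bar>?x - ?f ?x\<bar> + \<bar>?y - ?g ?y\<bar>"
      unfolding d norm_Pair using cmod_le[of "Complex (?x - ?f ?x) (?y - ?g ?y)"] by simp
    moreover have "\<bar>?f ?x - ?x\<bar> \<le> B" "\<bar>?g ?y - ?y\<bar> \<le> D"
      using line_map_interpolate[OF f t] line_map_interpolate[OF g t] unfolding line_map_def by blast+
    ultimately show ?thesis
      using norm_triangle_ineq2[of p "?h t p"] by linarith
  qed
  then show "\<exists>c>0. \<exists>D. \<forall>t\<in>{0..1}. \<forall>p. norm p \<le> c * norm (?h t p) + D"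
    by (intro exI[of _ 1] conjI exI[of _ "B + D"]) auto
qed

text \<open>The function \<open>sqrt\<close> is odd, so this is the signed square root on \<open>[-1, 1]\<close>.\<close>

definition bulge :: "real \<Rightarrow> real" where
  "bulge u = (if \<bar>u\<bar> \<le> 1 then sqrt u else u)"

lemma bulge_square:
  assumes "\<bar>v\<bar> \<le> 1"
  shows "bulge (v * \<bar>v\<bar>) = v"
proof -
  have "\<bar>v\<bar> * \<bar>v\<bar> \<le> 1"
    using assms by (intro mult_le_one) auto
  then have "\<bar>v * \<bar>v\<bar>\<bar> \<le> 1"
    by (simp add: abs_mult)
  moreover have "sqrt (v * \<bar>v\<bar>) = v"
    by (auto simp: abs_if real_sqrt_minus)
  ultimately show ?thesis
    by (simp add: bulge_def)
qed

lemma bulge_id: "1 \<le> \<bar>u\<bar> \<Longrightarrow> bulge u = u"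
  using real_sqrt_minus[of 1] by (auto simp: bulge_def abs_if split: if_splits)

lemma bulge_small: "\<bar>u\<bar> \<le> 1 \<Longrightarrow> \<bar>bulge u\<bar> \<le> 1"
  by (auto simp: bulge_def abs_le_iff) (metis minus_le_iff real_sqrt_le_1_iff real_sqrt_minus)

lemma line_map_bulge: "line_map bulge 1"
proof -
  define c where "c u = max (-1) (min 1 u)" for u :: real
  have bulge: "bulge = (\<lambda>u. sqrt (c u) + (u - c u))"
    using real_sqrt_minus[of 1] by (auto simp: fun_eq_iff bulge_def c_def max_def min_def)
  have "continuous_on UNIV bulge"
    unfolding bulge c_def by (intro continuous_intros)
  moreover have "strict_mono bulge"
  proof (rule strict_monoI)
    fix u v :: real
    assume "u < v"
    then have "c u \<le> c v" "c u < c v \<or> u - c u < v - c v" "u - c u \<le> v - c v"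
      by (auto simp: c_def)
    then show "bulge u < bulge v"
      unfolding bulge using real_sqrt_less_mono[of "c u" "c v"] real_sqrt_le_mono[of "c u" "c v"] by linarith
  qed
  moreover have "\<bar>bulge u - u\<bar> \<le> 1" for u
  proof (cases "0 \<le> u")
    case True
    then show ?thesis
      by (auto simp: bulge_def abs_le_iff) (smt (verit) real_sqrt_ge_zero real_sqrt_le_1_iff)+
  next
    case False
    then show ?thesis
      by (auto simp: bulge_def abs_le_iff) (smt (verit) real_sqrt_minus real_sqrt_le_0_iff real_sqrt_le_1_iff)+
  qed
  ultimately show ?thesis by (simp add: line_map_def)
qed

text \<open>The intervals \<open>[3 k - 1, 3 k + 1]\<close> are disjoint and each step moves the points of one of
  them only, so that the composition acts on each interval by its own copy of \<open>bulge\<close>.\<close>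

fun bulges :: "nat \<Rightarrow> real \<Rightarrow> real" where
  "bulges 0 x = x"
| "bulges (Suc k) x = 3 * real k + bulge (bulges k x - 3 * real k)"

lemma line_map_bulges: "line_map (bulges r) r"
proof (induction r)
  case 0
  have "bulges 0 = (\<lambda>x. x)" by auto
  then show ?case by (auto simp: line_map_def strict_mono_def)
next
  case (Suc r)
  have "bulges (Suc r) = (\<lambda>x. 3 * real r + bulge (bulges r x - 3 * real r))" by auto
  moreover have cont: "continuous_on UNIV bulge" "continuous_on UNIV (bulges r)"
    using Suc line_map_bulge by (simp_all add: line_map_def)
  have "continuous_on UNIV (\<lambda>x. 3 * real r + bulge (bulges r x - 3 * real r))"
    by (intro continuous_intros continuous_on_compose2[OF cont(1)] cont(2)) auto
  moreover have "strict_mono (\<lambda>x. 3 * real r + bulge (bulges r x - 3 * real r))"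
    using Suc line_map_bulge unfolding line_map_def strict_mono_def by auto
  moreover have "\<bar>3 * real r + bulge (bulges r x - 3 * real r) - x\<bar> \<le> real (Suc r)" for x
  proof -
    have "\<bar>bulge (bulges r x - 3 * real r) - (bulges r x - 3 * real r)\<bar> \<le> 1" "\<bar>bulges r x - x\<bar> \<le> real r"
      using Suc line_map_bulge unfolding line_map_def by blast+
    then show ?thesis by (simp add: abs_if split: if_splits)
  qed
  ultimately show ?case by (auto simp: line_map_def)
qed

lemma bulges_above: "3 * real r - 2 \<le> x \<Longrightarrow> bulges r x = x"
  by (induction r) (auto simp: bulge_id)

lemma bulges_at:
  assumes "\<bar>u\<bar> \<le> 1" "k < r"
  shows "bulges r (3 * real k + u) = 3 * real k + bulge u"
  using assms(2)
proof (induction r)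
  case (Suc r)
  show ?case
  proof (cases "k = r")
    case True
    then show ?thesis using assms(1) by (simp add: bulges_above)
  next
    case False
    then have "k < r" using Suc.prems by simp
    then have "real k + 1 \<le> real r" by linarith
    moreover have "bulges r (3 * real k + u) = 3 * real k + bulge u"
      by (rule Suc.IH[OF \<open>k < r\<close>])
    ultimately show ?thesis
      using bulge_small[OF assms(1)] bulge_id[of "3 * real k + bulge u - 3 * real r"] by simp
  qed
qed simp

section \<open>Links made of polygonal bigons\<close>

text \<open>The pairs of neighbours in a set of break points; they index the edges of a polygonal graph. A set
  has its neighbours without a choice of an enumeration, which makes successors of vertices unique at once.\<close>

definition consecutive :: "real set \<Rightarrow> (real \<times> real) set" where
  "consecutive X = {(x, y). x \<in> X \<and> y \<in> X \<and> x < y \<and> (\<forall>z\<in>X. z \<le> x \<or> y \<le> z)}"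

lemma consecutive_singleton [simp]: "consecutive {a} = {}"
  by (auto simp: consecutive_def)

lemma consecutive_insert [simp]:
  assumes "a < b" "\<forall>y\<in>Y. b \<le> y"
  shows "consecutive (insert a (insert b Y)) = insert (a, b) (consecutive (insert b Y))"
proof -
  have Y: "z \<in> insert b Y \<Longrightarrow> b \<le> z" for z
    using assms(2) by auto
  have "(x, y) \<in> consecutive (insert a (insert b Y)) \<longleftrightarrow> (x, y) = (a, b) \<or> (x, y) \<in> consecutive (insert b Y)" for x y
  proof (cases "x = a")
    case True
    have "(a, y) \<in> consecutive (insert a (insert b Y)) \<longleftrightarrow> y = b"
      using assms(1) Y[of y] by (auto simp: consecutive_def) (use Y in fastforce)+
    moreover have "(a, y) \<notin> consecutive (insert b Y)"
      using assms(1) Y[of a] by (auto simp: consecutive_def)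
    ultimately show ?thesis using True by simp
  next
    case False
    then show ?thesis
      using assms(1) Y[of x] by (auto simp: consecutive_def)
  qed
  then show ?thesis by auto
qed

lemma consecutive_subset: "consecutive X \<subseteq> X \<times> X"
  by (auto simp: consecutive_def)

lemma consecutive_overlap:
  assumes "(x, y) \<in> consecutive X" "(x', y') \<in> consecutive X" "z \<in> {x..y}" "z \<in> {x'..y'}"
  shows "(x, y) = (x', y') \<or> z \<in> {x, y} \<inter> {x', y'}"
proof -
  have "x' \<le> x \<or> y \<le> x'" "y' \<le> x \<or> y \<le> y'" "x \<le> x' \<or> y' \<le> x" "y \<le> x' \<or> y' \<le> y" "x < y" "x' < y'"
    using assms(1,2) by (auto simp: consecutive_def)
  then show ?thesis
    using assms(3,4) by auto
qed

lemma consecutive_next: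
  assumes "finite X" "x \<in> X" "r \<in> X" "x < r"
  shows "\<exists>y. (x, y) \<in> consecutive X"
proof -
  let ?S = "{y \<in> X. x < y}"
  have "Min ?S \<in> ?S"
    using assms by (intro Min_in) auto
  moreover have "Min ?S \<le> z" if "z \<in> ?S" for z
    using assms(1) that by auto
  ultimately have "(x, Min ?S) \<in> consecutive X"
    using assms(2) by (force simp: consecutive_def)
  then show ?thesis ..
qed

lemma consecutive_previous:
  assumes "finite X" "x \<in> X" "l \<in> X" "l < x"
  shows "\<exists>y. (y, x) \<in> consecutive X"
proof -
  let ?S = "{y \<in> X. y < x}"
  have "Max ?S \<in> ?S"
    using assms by (intro Max_in) auto
  moreover have "z \<le> Max ?S" if "z \<in> ?S" for z
    using assms(1) that by auto
  ultimately have "(Max ?S, x) \<in> consecutive X"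
    using assms(2) by (force simp: consecutive_def)
  then show ?thesis ..
qed

lemma consecutive_cover:
  assumes "finite X" "l \<in> X" "r \<in> X" "l < r" "z \<in> {l..r}"
  obtains x y where "(x, y) \<in> consecutive X" "z \<in> {x..y}"
proof (cases "z = r")
  case True
  then show thesis using consecutive_previous[OF assms(1,3,2,4)] that by (force simp: consecutive_def)
next
  case False
  let ?S = "{x \<in> X. x \<le> z}"
  have M: "Max ?S \<in> ?S"
    using assms by (intro Max_in) auto
  then have "Max ?S < r" using False assms(5) by auto
  then obtain y where y: "(Max ?S, y) \<in> consecutive X"
    using consecutive_next[OF assms(1) _ assms(3)] M by blast
  have "z \<le> y"
  proof (rule ccontr)
    assume "\<not> z \<le> y"
    then have "y \<le> Max ?S"
      using y assms(1) by (intro Max_ge) (auto simp: consecutive_def)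
    then show False using y by (simp add: consecutive_def)
  qed
  with y M that show thesis by auto
qed

text \<open>Linear interpolation, written without division so that concrete instances are polynomial identities.\<close>

definition affine_between :: "(real \<Rightarrow> complex) \<Rightarrow> real \<Rightarrow> real \<Rightarrow> bool" where
  "affine_between f x y \<longleftrightarrow> (\<forall>z\<in>{x..y}. (y - x) *\<^sub>R f z = (y - z) *\<^sub>R f x + (z - x) *\<^sub>R f y)"

lemma pt_convex_combination:
  "(1 - u) *\<^sub>R pt x v + u *\<^sub>R pt y w = pt ((1 - u) * x + u * y) ((1 - u) *\<^sub>R v + u *\<^sub>R w)"
  by (simp add: pt_def prod_eq_iff complex_eq_iff)

lemma closed_segment_graph:
  assumes "x < y" "affine_between f x y"
  shows "closed_segment (pt x (f x)) (pt y (f y)) = (\<lambda>z. pt z (f z)) ` {x..y}"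
proof -
  have affine: "f ((1 - u) * x + u * y) = (1 - u) *\<^sub>R f x + u *\<^sub>R f y" if "u \<in> {0..1}" for u
  proof -
    let ?z = "(1 - u) * x + u * y"
    have "0 \<le> u * (y - x)" "u * (y - x) \<le> y - x"
      using that assms(1) mult_right_mono[of u 1 "y - x"] by auto
    then have "?z \<in> {x..y}"
      by (simp add: algebra_simps)
    then have "(y - x) *\<^sub>R f ?z = (y - ?z) *\<^sub>R f x + (?z - x) *\<^sub>R f y"
      using assms(2) by (simp add: affine_between_def)
    also have "\<dots> = (y - x) *\<^sub>R ((1 - u) *\<^sub>R f x + u *\<^sub>R f y)"
      by (simp add: scaleR_add_right algebra_simps)
    finally show ?thesis using assms(1) by simp
  qed
  have "closed_segment (pt x (f x)) (pt y (f y)) = (\<lambda>u. pt ((1 - u) * x + u * y) (f ((1 - u) * x + u * y))) ` {0..1}"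
    unfolding closed_segment_def pt_convex_combination using affine by auto
  also have "\<dots> = (\<lambda>z. pt z (f z)) ` ((\<lambda>u. (1 - u) * x + u * y) ` {0..1})"
    by (simp add: image_image)
  also have "(\<lambda>u. (1 - u) * x + u * y) ` {0..1} = {x..y}"
    using assms(1) closed_segment_real_eq[of x y] closed_segment_eq_real_ivl[of x y]
    by (simp add: closed_segment_image_interval)
  finally show ?thesis .
qed

text \<open>A parametrization of the diamond \<open>\<bar>x\<bar> + \<bar>y\<bar> = 1\<close> by the angle on the circle: the signed squares
  of cosine and sine.\<close>

definition diamond_x :: "real \<Rightarrow> real" where
  "diamond_x t = cos (2 * pi * t) * \<bar>cos (2 * pi * t)\<bar>"

definition diamond_y :: "real \<Rightarrow> real" where
  "diamond_y t = sin (2 * pi * t) * \<bar>sin (2 * pi * t)\<bar>"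

lemma diamond_abs: "\<bar>diamond_x t\<bar> + \<bar>diamond_y t\<bar> = 1"
  using sin_cos_squared_add2[of "2 * pi * t"]
  by (simp add: diamond_x_def diamond_y_def abs_mult power2_eq_square)

lemma mult_abs_less_iff: "u * \<bar>u\<bar> < v * \<bar>v\<bar> \<longleftrightarrow> u < (v :: real)"
proof -
  have mono: "u * \<bar>u\<bar> < v * \<bar>v\<bar>" if "u < v" for u v :: real
  proof (cases "0 \<le> u")
    case True
    then show ?thesis using that by (simp add: mult_strict_mono)
  next
    case False
    show ?thesis
    proof (cases "0 \<le> v")
      case True
      then have "0 \<le> v * \<bar>v\<bar>" by simp
      moreover have "u * \<bar>u\<bar> < 0" by (rule mult_neg_pos) (use False in auto)
      ultimately show ?thesis by linarith
    next
      case False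
      then have "(- v) * (- v) < (- u) * (- u)"
        using that by (intro mult_strict_mono) auto
      then show ?thesis using False that by simp
    qed
  qed
  show ?thesis using mono[of u v] mono[of v u] by (cases u v rule: linorder_cases) auto
qed

lemma mult_abs_eq_iff: "u * \<bar>u\<bar> = v * \<bar>v\<bar> \<longleftrightarrow> u = (v :: real)"
  using mult_abs_less_iff[of u v] mult_abs_less_iff[of v u] by force

lemma diamond_eq_iff: "diamond_x s = diamond_x t \<and> diamond_y s = diamond_y t \<longleftrightarrow> s - t \<in> \<int>"
proof -
  have "diamond_x s = diamond_x t \<and> diamond_y s = diamond_y t \<longleftrightarrow> (\<exists>n::int. 2 * pi * s = 2 * pi * t + 2 * pi * real_of_int n)"
    unfolding diamond_x_def diamond_y_def mult_abs_eq_iff by (subst conj_commute) (rule sin_cos_eq_iff)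
  also have "\<dots> \<longleftrightarrow> (\<exists>n::int. 2 * pi * s = 2 * pi * (t + real_of_int n))"
    by (simp only: distrib_left)
  also have "\<dots> \<longleftrightarrow> (\<exists>n::int. s - t = real_of_int n)"
    unfolding mult_cancel_left by (simp add: diff_eq_eq add.commute)
  finally show ?thesis by (auto simp: Ints_def)
qed

lemma diamond_x_reflect: "diamond_x (1 - t) = diamond_x t"
  by (simp add: diamond_x_def right_diff_distrib cos_diff)

lemma diamond_y_sign:
  "0 \<le> t \<Longrightarrow> t \<le> 1/2 \<Longrightarrow> 0 \<le> diamond_y t"
  "1/2 \<le> t \<Longrightarrow> t \<le> 1 \<Longrightarrow> diamond_y t \<le> 0"
proof -
  show "0 \<le> diamond_y t" if "0 \<le> t" "t \<le> 1/2"
    using that sin_ge_zero[of "2 * pi * t"] by (simp add: diamond_y_def)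
  show "diamond_y t \<le> 0" if t: "1/2 \<le> t" "t \<le> 1"
  proof -
    have "0 \<le> sin (2 * pi * (1 - t))"
      using t by (intro sin_ge_zero) auto
    then have "sin (2 * pi * t) \<le> 0"
      by (simp add: right_diff_distrib sin_diff)
    then show ?thesis by (simp add: diamond_y_def mult_le_0_iff)
  qed
qed

lemma diamond_x_mono:
  assumes "1/2 \<le> s" "s < t" "t \<le> 1"
  shows "diamond_x s < diamond_x t"
proof -
  have "cos (2 * pi * (1 - s)) < cos (2 * pi * (1 - t))"
    using assms by (intro cos_monotone_0_pi) auto
  then show ?thesis
    unfolding diamond_x_def mult_abs_less_iff by (simp add: right_diff_distrib cos_diff)
qed

lemma continuous_on_diamond: "continuous_on S diamond_x" "continuous_on S diamond_y"
  unfolding diamond_x_def diamond_y_def by (intro continuous_intros)+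

definition sweep :: "real \<Rightarrow> real \<Rightarrow> real \<Rightarrow> real" where
  "sweep l r t = (l + r) / 2 + (r - l) / 2 * diamond_x t"

definition bigon_circle :: "real \<Rightarrow> real \<Rightarrow> (real \<Rightarrow> complex) \<Rightarrow> (real \<Rightarrow> complex) \<Rightarrow> real \<Rightarrow> space3" where
  "bigon_circle l r F G t = pt (sweep l r t) (if diamond_y t \<le> 0 then G (sweep l r t) else F (sweep l r t))"

text \<open>During the lower half of the circle, the parameter sweeps the interval monotonically from left to
  right.\<close>

lemma sweep_interval:
  assumes "l < r" "l \<le> x" "x < y" "y \<le> r"
  obtains s t where "1/2 \<le> s" "s < t" "t \<le> 1" "sweep l r s = x" "sweep l r t = y" "sweep l r ` {s..t} = {x..y}"
proof -
  let ?X = "sweep l r"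
  have cont: "continuous_on S ?X" for S
    unfolding sweep_def by (intro continuous_intros continuous_on_diamond)
  have mono: "?X s < ?X t" if "1/2 \<le> s" "s < t" "t \<le> 1" for s t
    unfolding sweep_def using diamond_x_mono[OF that] assms(1) by simp
  have ends: "?X (1/2) = l" "?X 1 = r"
    by (simp_all add: sweep_def diamond_x_def field_simps)
  obtain s where s: "1/2 \<le> s" "s \<le> 1" "?X s = x"
    using IVT'[of ?X "1/2" x 1] cont ends assms by auto
  obtain t where t: "1/2 \<le> t" "t \<le> 1" "?X t = y"
    using IVT'[of ?X "1/2" y 1] cont ends assms by auto
  have "s < t"
    using mono[of t s] s t assms(3) by (cases s t rule: linorder_cases) auto
  moreover have "?X ` {s..t} = {x..y}"
  proof (intro equalityI subsetI)
    fix z assume "z \<in> ?X ` {s..t}"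
    then obtain u where u: "u \<in> {s..t}" "z = ?X u" by auto
    then have "?X s \<le> ?X u" "?X u \<le> ?X t"
      using mono[of s u] mono[of u t] s t by (cases "s = u"; cases "u = t"; force)+
    then show "z \<in> {x..y}" using u s t by simp
  next
    fix z assume "z \<in> {x..y}"
    then show "z \<in> ?X ` {s..t}"
      using IVT'[of ?X s z t] cont s t \<open>s < t\<close> by auto
  qed
  ultimately show thesis using that s t by blast
qed

text \<open>The upper half retraces the lower half backwards, which spares a second monotonicity argument.\<close>

lemma sweep_reflect: "sweep l r (1 - t) = sweep l r t"
  by (simp add: sweep_def diamond_x_reflect)

lemma sweep_reflect_image: "sweep l r ` {1 - t..1 - s} = sweep l r ` {s..t}"
proof -
  have eq: "{1 - t..1 - s} = (\<lambda>u. 1 - u) ` {s..t}"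
    by (metis image_diff_atLeastAtMost)
  show ?thesis unfolding eq image_image sweep_reflect ..
qed

definition graph_edges :: "(real \<Rightarrow> complex) \<Rightarrow> real set \<Rightarrow> (space3 \<times> space3) set" where
  "graph_edges f X = (\<lambda>(x, y). (pt x (f x), pt y (f y))) ` consecutive X"

definition bigon_edges :: "real set \<Rightarrow> (real \<Rightarrow> complex) \<Rightarrow> real set \<Rightarrow> (real \<Rightarrow> complex) \<Rightarrow> (space3 \<times> space3) set" where
  "bigon_edges X F Y G = graph_edges G Y \<union> (graph_edges F X)\<inverse>"

text \<open>A closed polygon formed by the graph of \<open>G\<close>, run through to the right, and the graph of \<open>F\<close>, run through to
  the left. The sets \<open>Y\<close> and \<open>X\<close> contain their break points. With \<open>F\<close> above \<open>G\<close> in the plane, the orientation is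
  counterclockwise; but the two graphs may cross in the projection.\<close>

locale bigon =
  fixes l r :: real and X F Y G
  assumes less: "l < r"
    and X: "finite X" "l \<in> X" "r \<in> X" "X \<subseteq> {l..r}"
    and Y: "finite Y" "l \<in> Y" "r \<in> Y" "Y \<subseteq> {l..r}"
    and cont: "continuous_on {l..r} F" "continuous_on {l..r} G"
    and affine_F: "\<And>x y. (x, y) \<in> consecutive X \<Longrightarrow> affine_between F x y"
    and affine_G: "\<And>x y. (x, y) \<in> consecutive Y \<Longrightarrow> affine_between G x y"
    and ends: "F l = G l" "F r = G r"
    and distinct: "\<And>x. l < x \<Longrightarrow> x < r \<Longrightarrow> F x \<noteq> G x"
    and finite_crossings: "finite {x \<in> {l..r}. Re (F x) = Re (G x)}"
    and regular_vertex: "\<And>x. x \<in> X \<union> Y \<Longrightarrow> l < x \<Longrightarrow> x < r \<Longrightarrow> Re (F x) \<noteq> Re (G x)"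
begin

abbreviation "circle \<equiv> bigon_circle l r F G"
abbreviation "edges \<equiv> bigon_edges X F Y G"

text \<open>Two edges on different graphs can thus meet over the ends of the interval only.\<close>

lemma agree_iff: "x \<in> {l..r} \<Longrightarrow> F x = G x \<longleftrightarrow> x = l \<or> x = r"
  using distinct[of x] ends by force

lemma edge_cases [consumes 1]:
  assumes "(u, v) \<in> edges"
  obtains (lower) x y where "(x, y) \<in> consecutive Y" "u = pt x (G x)" "v = pt y (G y)"
      "closed_segment u v = (\<lambda>z. pt z (G z)) ` {x..y}" "l \<le> x" "x < y" "y \<le> r"
    | (upper) x y where "(x, y) \<in> consecutive X" "u = pt y (F y)" "v = pt x (F x)"
      "closed_segment u v = (\<lambda>z. pt z (F z)) ` {x..y}" "l \<le> x" "x < y" "y \<le> r"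
proof -
  have "(\<exists>x y. (x, y) \<in> consecutive Y \<and> u = pt x (G x) \<and> v = pt y (G y)) \<or>
        (\<exists>x y. (x, y) \<in> consecutive X \<and> u = pt y (F y) \<and> v = pt x (F x))"
    using assms by (auto simp: bigon_edges_def graph_edges_def)
  then show thesis
  proof (elim disjE exE conjE)
    fix x y
    assume *: "(x, y) \<in> consecutive Y" "u = pt x (G x)" "v = pt y (G y)"
    then have "x < y" "l \<le> x" "y \<le> r" using Y(4) by (auto simp: consecutive_def)
    then show thesis using * lower closed_segment_graph[OF _ affine_G] by metis
  next
    fix x y
    assume *: "(x, y) \<in> consecutive X" "u = pt y (F y)" "v = pt x (F x)"
    then have "x < y" "l \<le> x" "y \<le> r" using X(4) by (auto simp: consecutive_def)
    then show thesis using * upper closed_segment_graph[OF _ affine_F] closed_segment_commute by metis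
  qed
qed

lemma lower_edge: "(x, y) \<in> consecutive Y \<Longrightarrow> (pt x (G x), pt y (G y)) \<in> edges"
  by (force simp: bigon_edges_def graph_edges_def)

lemma upper_edge: "(x, y) \<in> consecutive X \<Longrightarrow> (pt y (F y), pt x (F x)) \<in> edges"
  by (force simp: bigon_edges_def graph_edges_def)

lemma carrier_eq: "carrier_of edges = (\<lambda>x. pt x (G x)) ` {l..r} \<union> (\<lambda>x. pt x (F x)) ` {l..r}"
proof (intro equalityI subsetI)
  fix p assume "p \<in> carrier_of edges"
  then obtain u v where "(u, v) \<in> edges" "p \<in> closed_segment u v"
    by (auto simp: carrier_of_def)
  then show "p \<in> (\<lambda>x. pt x (G x)) ` {l..r} \<union> (\<lambda>x. pt x (F x)) ` {l..r}"
    by (cases rule: edge_cases) auto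
next
  fix p assume "p \<in> (\<lambda>x. pt x (G x)) ` {l..r} \<union> (\<lambda>x. pt x (F x)) ` {l..r}"
  then obtain z where z: "z \<in> {l..r}" "p = pt z (G z) \<or> p = pt z (F z)" by auto
  from z(2) show "p \<in> carrier_of edges"
  proof
    assume p: "p = pt z (G z)"
    obtain x y where xy: "(x, y) \<in> consecutive Y" "z \<in> {x..y}"
      using consecutive_cover[OF Y(1-3) less z(1)] .
    then have "closed_segment (pt x (G x)) (pt y (G y)) = (\<lambda>z. pt z (G z)) ` {x..y}"
      by (intro closed_segment_graph affine_G) (auto simp: consecutive_def)
    then show ?thesis
      unfolding carrier_of_def using lower_edge[OF xy(1)] xy(2) p by blast
  next
    assume p: "p = pt z (F z)"
    obtain x y where xy: "(x, y) \<in> consecutive X" "z \<in> {x..y}"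
      using consecutive_cover[OF X(1-3) less z(1)] .
    then have "closed_segment (pt y (F y)) (pt x (F x)) = (\<lambda>z. pt z (F z)) ` {x..y}"
      unfolding closed_segment_commute[of "pt y (F y)"]
      by (intro closed_segment_graph affine_F) (auto simp: consecutive_def)
    then show ?thesis
      unfolding carrier_of_def using upper_edge[OF xy(1)] xy(2) p by blast
  qed
qed

lemma carrier_range: "p \<in> carrier_of edges \<Longrightarrow> Re (fst p) \<in> {l..r}"
  by (auto simp: carrier_eq fst_pt)

text \<open>Sources and targets of edges are the same vertices: at both ends of the interval, where one graph is
  left and the other one is entered, the two graphs share a vertex.\<close>

lemma sources: "fst ` edges = (\<lambda>x. pt x (G x)) ` Y \<union> (\<lambda>x. pt x (F x)) ` X"
proof -
  have "fst ` consecutive Y = Y - {r}"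
    using consecutive_next[OF Y(1) _ Y(3)] Y(4) by (force simp: consecutive_def image_iff)
  moreover have "snd ` consecutive X = X - {l}"
    using consecutive_previous[OF X(1) _ X(2)] X(4) by (force simp: consecutive_def image_iff)
  moreover have "fst ` edges = (\<lambda>x. pt x (G x)) ` (fst ` consecutive Y) \<union> (\<lambda>x. pt x (F x)) ` (snd ` consecutive X)"
    by (force simp: bigon_edges_def graph_edges_def)
  moreover have "pt l (F l) \<in> (\<lambda>x. pt x (G x)) ` (Y - {r})" "pt r (G r) \<in> (\<lambda>x. pt x (F x)) ` (X - {l})"
    using ends X Y less by force+
  ultimately show ?thesis by auto
qed

lemma targets: "snd ` edges = (\<lambda>x. pt x (G x)) ` Y \<union> (\<lambda>x. pt x (F x)) ` X"
proof -
  have "snd ` consecutive Y = Y - {l}"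
    using consecutive_previous[OF Y(1) _ Y(2)] Y(4) by (force simp: consecutive_def image_iff)
  moreover have "fst ` consecutive X = X - {r}"
    using consecutive_next[OF X(1) _ X(3)] X(4) by (force simp: consecutive_def image_iff)
  moreover have "snd ` edges = (\<lambda>x. pt x (G x)) ` (snd ` consecutive Y) \<union> (\<lambda>x. pt x (F x)) ` (fst ` consecutive X)"
    by (force simp: bigon_edges_def graph_edges_def)
  moreover have "pt r (F r) \<in> (\<lambda>x. pt x (G x)) ` (Y - {l})" "pt l (G l) \<in> (\<lambda>x. pt x (F x)) ` (X - {r})"
    using ends X Y less by force+
  ultimately show ?thesis by auto
qed

lemma segment_intersection:
  assumes "(u, v) \<in> edges" "(u', v') \<in> edges" "(u, v) \<noteq> (u', v')"
  shows "closed_segment u v \<inter> closed_segment u' v' \<subseteq> {u, v} \<inter> {u', v'}"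
proof
  fix p assume "p \<in> closed_segment u v \<inter> closed_segment u' v'"
  then have p: "p \<in> closed_segment u v" "p \<in> closed_segment u' v'" by auto
  have mixed: "z \<in> {x, y} \<inter> {x', y'}"
    if "F z = G z" "z \<in> {x..y}" "z \<in> {x'..y'}" "l \<le> x" "y \<le> r" "l \<le> x'" "y' \<le> r" for x y x' y' z
    using that agree_iff[of z] by auto
  from assms(1) show "p \<in> {u, v} \<inter> {u', v'}"
  proof (cases rule: edge_cases)
    case L: (lower x y)
    from assms(2) show ?thesis
    proof (cases rule: edge_cases)
      case (lower x' y')
      obtain z where z: "z \<in> {x..y}" "z \<in> {x'..y'}" "p = pt z (G z)"
        using p L(4) lower(4) by auto
      have "(x, y) \<noteq> (x', y')" using assms(3) L lower by auto
      then have "z \<in> {x, y} \<inter> {x', y'}"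
        using consecutive_overlap[OF L(1) lower(1) z(1,2)] by blast
      then show ?thesis using L lower z(3) by auto
    next
      case (upper x' y')
      obtain z where z: "z \<in> {x..y}" "z \<in> {x'..y'}" "p = pt z (G z)" "p = pt z (F z)"
        using p L(4) upper(4) by auto
      then show ?thesis using mixed[of z x y x' y'] L upper by auto
    qed
  next
    case U: (upper x y)
    from assms(2) show ?thesis
    proof (cases rule: edge_cases)
      case (lower x' y')
      obtain z where z: "z \<in> {x..y}" "z \<in> {x'..y'}" "p = pt z (G z)" "p = pt z (F z)"
        using p U(4) lower(4) by auto
      then show ?thesis using mixed[of z x y x' y'] U lower by auto
    next
      case (upper x' y')
      obtain z where z: "z \<in> {x..y}" "z \<in> {x'..y'}" "p = pt z (F z)"
        using p U(4) upper(4) by auto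
      have "(x, y) \<noteq> (x', y')" using assms(3) U upper by auto
      then have "z \<in> {x, y} \<inter> {x', y'}"
        using consecutive_overlap[OF U(1) upper(1) z(1,2)] by blast
      then show ?thesis using U upper z(3) by auto
    qed
  qed
qed

lemma source_unique:
  assumes "(u, v) \<in> edges" "(u, v') \<in> edges"
  shows "v = v'"
  using assms(1)
proof (cases rule: edge_cases)
  case L: (lower x y)
  from assms(2) show ?thesis
  proof (cases rule: edge_cases)
    case (lower x' y')
    then show ?thesis using L unfolding consecutive_def by force
  next
    case (upper x' y')
    then show ?thesis using L agree_iff[of x] by auto
  qed
next
  case U: (upper x y)
  from assms(2) show ?thesis
  proof (cases rule: edge_cases)
    case (lower x' y')
    then show ?thesis using U agree_iff[of x'] by auto
  next
    case (upper x' y')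
    then show ?thesis using U unfolding consecutive_def by force
  qed
qed

lemma target_unique:
  assumes "(u, v) \<in> edges" "(u', v) \<in> edges"
  shows "u = u'"
  using assms(1)
proof (cases rule: edge_cases)
  case L: (lower x y)
  from assms(2) show ?thesis
  proof (cases rule: edge_cases)
    case (lower x' y')
    then show ?thesis using L unfolding consecutive_def by force
  next
    case (upper x' y')
    then show ?thesis using L agree_iff[of y] by auto
  qed
next
  case U: (upper x y)
  from assms(2) show ?thesis
  proof (cases rule: edge_cases)
    case (lower x' y')
    then show ?thesis using U agree_iff[of y'] by auto
  next
    case (upper x' y')
    then show ?thesis using U unfolding consecutive_def by force
  qed
qed

lemma polygonal: "polygonal_link edges"
proof -
  have "finite (consecutive X)" "finite (consecutive Y)"
    using X(1) Y(1) by (auto intro: finite_subset[OF consecutive_subset])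
  then have "finite edges"
    by (simp add: bigon_edges_def graph_edges_def)
  moreover have "edges \<noteq> {}"
    using sources Y(2) by auto
  moreover have "\<forall>(u, v)\<in>edges. u \<noteq> v \<and> (\<exists>!w. (v, w) \<in> edges) \<and> (\<exists>!w. (w, u) \<in> edges)"
  proof (intro ballI case_prodI2 conjI)
    fix e u v
    assume "e \<in> edges" "e = (u, v)"
    then have uv: "(u, v) \<in> edges" by simp
    show "u \<noteq> v"
      using uv by (cases rule: edge_cases) auto
    have "v \<in> snd ` edges" "u \<in> fst ` edges"
      using uv by force+
    then have "v \<in> fst ` edges" "u \<in> snd ` edges"
      by (simp_all add: sources targets)
    then obtain w w' where "(v, w) \<in> edges" "(w', u) \<in> edges"
      by auto
    then show "\<exists>!w. (v, w) \<in> edges" "\<exists>!w. (w, u) \<in> edges"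
      using source_unique target_unique by blast+
  qed
  moreover have "\<forall>(u, v)\<in>edges. \<forall>(u', v')\<in>edges. (u, v) \<noteq> (u', v') \<longrightarrow>
      closed_segment u v \<inter> closed_segment u' v' \<subseteq> {u, v} \<inter> {u', v'}"
    using segment_intersection by blast
  ultimately show ?thesis
    unfolding polygonal_link_def by (intro conjI)
qed

text \<open>At most two points of the bigon have a given \<open>x\<close>-coordinate, so multiple points of the projection are
  the double points where the real parts of \<open>F\<close> and \<open>G\<close> agree.\<close>

lemma regular: "regular_projection edges"
  unfolding regular_projection_def
proof (intro conjI allI)
  have over: "p = pt x (F x) \<or> p = pt x (G x)" "x \<in> {l..r}" if "p \<in> carrier_of edges" "fst p = z" "x = Re z" for p x z
    using that by (auto simp: carrier_eq fst_pt)
  have "{z. \<exists>p\<in>carrier_of edges. \<exists>q\<in>carrier_of edges. p \<noteq> q \<and> fst p = z \<and> fst q = z}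
    \<subseteq> (\<lambda>x. Complex x (Re (F x))) ` {x \<in> {l..r}. Re (F x) = Re (G x)}"
  proof (intro subsetI, elim CollectE bexE conjE)
    fix z p q
    assume *: "p \<in> carrier_of edges" "q \<in> carrier_of edges" "p \<noteq> q" and z: "fst p = z" "fst q = z"
    then have fst_eq: "fst q = fst p" by simp
    let ?x = "Re (fst p)"
    have "p = pt ?x (F ?x) \<and> q = pt ?x (G ?x) \<or> p = pt ?x (G ?x) \<and> q = pt ?x (F ?x)"
      using over[OF *(1) refl refl] over[OF *(2) fst_eq refl] *(3) by blast
    then have "fst p = Complex ?x (Re (F ?x))" "Re (F ?x) = Re (G ?x)"
      using fst_eq fst_pt by (metis complex.sel(2))+
    then show "z \<in> (\<lambda>x. Complex x (Re (F x))) ` {x \<in> {l..r}. Re (F x) = Re (G x)}"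
      using over(2)[OF *(1) refl refl] unfolding z(1)[symmetric] by blast
  qed
  then show "finite {z. \<exists>p\<in>carrier_of edges. \<exists>q\<in>carrier_of edges. p \<noteq> q \<and> fst p = z \<and> fst q = z}"
    by (rule finite_subset) (rule finite_imageI[OF finite_crossings])
  show "card {p \<in> carrier_of edges. fst p = z} \<le> 2" for z
  proof -
    have "card {p \<in> carrier_of edges. fst p = z} \<le> card {pt (Re z) (F (Re z)), pt (Re z) (G (Re z))}"
      using over by (intro card_mono) auto
    also have "\<dots> \<le> 2" by (simp add: card_insert_if)
    finally show ?thesis .
  qed
  have "p = u" if "(u, v) \<in> edges" "p \<in> carrier_of edges" "fst p = fst u" for u v p
  proof -
    have "u \<in> fst ` edges" using that(1) by force
    then consider x where "x \<in> Y" "u = pt x (G x)" | x where "x \<in> X" "u = pt x (F x)"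
      unfolding sources by blast
    then obtain x where x: "x \<in> X \<union> Y" "u = pt x (F x) \<or> u = pt x (G x)" "x \<in> {l..r}"
      by cases (use X(4) Y(4) in blast)+
    then have p: "p = pt x (F x) \<or> p = pt x (G x)"
      using over[OF that(2,3)] by (auto simp: fst_pt)
    show ?thesis
    proof (cases "l < x \<and> x < r")
      case True
      then have "Re (F x) \<noteq> Re (G x)" using regular_vertex[OF x(1)] by simp
      then show ?thesis using p x(2) that(3) by (auto simp: fst_pt)
    next
      case False
      then have "F x = G x" using agree_iff[OF x(3)] x(3) by auto
      then show ?thesis using p x(2) by auto
    qed
  qed
  then show "\<forall>(u, v)\<in>edges. \<forall>p\<in>carrier_of edges. fst p = fst u \<longrightarrow> p = u"
    by blast
qed

lemma circle_lower: "diamond_y t \<le> 0 \<Longrightarrow> circle t = pt (sweep l r t) (G (sweep l r t))"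
  by (simp add: bigon_circle_def)

lemma sweep_range: "sweep l r t \<in> {l..r}"
proof -
  have "\<bar>diamond_x t\<bar> \<le> 1" using diamond_abs[of t] by linarith
  then have "\<bar>(r - l) / 2 * diamond_x t\<bar> \<le> (r - l) / 2 * 1"
    unfolding abs_mult using less by (intro mult_mono) auto
  then show ?thesis by (auto simp: sweep_def abs_le_iff field_simps)
qed

lemma sweep_end:
  assumes "diamond_y t = 0"
  shows "sweep l r t = l \<or> sweep l r t = r"
proof -
  have "diamond_x t = 1 \<or> diamond_x t = -1" using diamond_abs[of t] assms by linarith
  then show ?thesis by (auto simp: sweep_def field_simps)
qed

lemma circle_upper: "0 \<le> diamond_y t \<Longrightarrow> circle t = pt (sweep l r t) (F (sweep l r t))"
  using sweep_end[of t] ends by (auto simp: bigon_circle_def)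

text \<open>The \<open>x\<close>-coordinate determines the diamond point up to reflection in the axis, and the reflected point
  lies on the other graph, which is disjoint from the first one except at the ends.\<close>

lemma embedded: "embedded_circle circle"
  unfolding embedded_circle_def
proof (intro conjI allI)
  have cont_sweep: "continuous_on S (sweep l r)" for S
    unfolding sweep_def by (intro continuous_intros continuous_on_diamond)
  have *: "continuous_on S (\<lambda>t. F (sweep l r t))" "continuous_on S (\<lambda>t. G (sweep l r t))" for S
    using sweep_range by (auto intro!: continuous_on_compose2[OF cont(1) cont_sweep] continuous_on_compose2[OF cont(2) cont_sweep])
  have "continuous_on UNIV (\<lambda>t. if diamond_y t \<le> 0 then G (sweep l r t) else F (sweep l r t))"
    using sweep_end ends by (intro continuous_on_cases_le * continuous_on_diamond) (metis)
  then show "continuous_on UNIV circle"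
    unfolding bigon_circle_def by (intro continuous_intros cont_sweep)
next
  fix s t
  show "circle s = circle t \<longleftrightarrow> s - t \<in> \<int>"
  proof
    assume eq: "circle s = circle t"
    then have sw: "sweep l r s = sweep l r t" by (simp add: bigon_circle_def)
    then have dx: "diamond_x s = diamond_x t" using less by (simp add: sweep_def)
    then have abs: "\<bar>diamond_y s\<bar> = \<bar>diamond_y t\<bar>" using diamond_abs[of s] diamond_abs[of t] by linarith
    have "diamond_y s = diamond_y t"
    proof (rule ccontr)
      assume ne: "diamond_y s \<noteq> diamond_y t"
      then have "diamond_y s < 0 \<and> 0 < diamond_y t \<or> diamond_y t < 0 \<and> 0 < diamond_y s"
        using abs by (auto simp: abs_if split: if_splits)
      then have "F (sweep l r t) = G (sweep l r t)"
        using eq sw by (auto simp: bigon_circle_def)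
      then have "sweep l r t = l \<or> sweep l r t = r"
        using agree_iff sweep_range by blast
      then have "(r - l) * diamond_x t = (r - l) * 1 \<or> (r - l) * diamond_x t = (r - l) * (-1)"
        by (auto simp: sweep_def field_simps)
      then have "diamond_x t = 1 \<or> diamond_x t = -1"
        using less by (metis diff_gt_0_iff_gt less_irrefl mult_left_cancel)
      then have "diamond_y t = 0" "diamond_y s = 0"
        using diamond_abs[of t] abs by auto
      then show False using ne by simp
    qed
    then show "s - t \<in> \<int>" using dx diamond_eq_iff by blast
  next
    assume "s - t \<in> \<int>"
    then show "circle s = circle t"
      using diamond_eq_iff[of s t] by (simp add: bigon_circle_def sweep_def)
  qed
qed

lemma traverse_edge:
  assumes "(u, v) \<in> edges"
  shows "\<exists>s t. s < t \<and> t < s + 1 \<and> circle s = u \<and> circle t = v \<and> circle ` {s..t} = closed_segment u v"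
  using assms
proof (cases rule: edge_cases)
  case (lower x y)
  obtain s t where st: "1/2 \<le> s" "s < t" "t \<le> 1" "sweep l r s = x" "sweep l r t = y" "sweep l r ` {s..t} = {x..y}"
    using sweep_interval[OF less lower(5-7)] .
  have c: "circle a = pt (sweep l r a) (G (sweep l r a))" if "a \<in> {s..t}" for a
    using that st by (intro circle_lower diamond_y_sign) auto
  have "circle ` {s..t} = (\<lambda>a. pt (sweep l r a) (G (sweep l r a))) ` {s..t}"
    by (rule image_cong[OF refl c])
  also have "\<dots> = (\<lambda>z. pt z (G z)) ` (sweep l r ` {s..t})"
    by (simp add: image_image)
  finally have "circle ` {s..t} = closed_segment u v"
    using st lower by simp
  then show ?thesis
    using st lower c[of s] c[of t] by (intro exI[of _ s] exI[of _ t]) auto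
next
  case (upper x y)
  obtain s t where st: "1/2 \<le> s" "s < t" "t \<le> 1" "sweep l r s = x" "sweep l r t = y" "sweep l r ` {s..t} = {x..y}"
    using sweep_interval[OF less upper(5-7)] .
  have c: "circle a = pt (sweep l r a) (F (sweep l r a))" if "a \<in> {1-t..1-s}" for a
    using that st by (intro circle_upper diamond_y_sign) auto
  have "circle ` {1-t..1-s} = (\<lambda>a. pt (sweep l r a) (F (sweep l r a))) ` {1-t..1-s}"
    by (rule image_cong[OF refl c])
  also have "\<dots> = (\<lambda>z. pt z (F z)) ` (sweep l r ` {1-t..1-s})"
    by (simp add: image_image)
  finally have "circle ` {1-t..1-s} = closed_segment u v"
    using st upper by (simp add: sweep_reflect_image)
  then show ?thesis
    using st upper c[of "1-s"] c[of "1-t"]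
    by (intro exI[of _ "1-t"] exI[of _ "1-s"]) (auto simp: sweep_reflect)
qed

lemma range_circle: "range circle = carrier_of edges"
proof (intro equalityI subsetI)
  fix p assume "p \<in> range circle"
  then show "p \<in> carrier_of edges"
    using sweep_range unfolding carrier_eq bigon_circle_def by auto
next
  fix p assume "p \<in> carrier_of edges"
  then obtain z where z: "z \<in> {l..r}" "p = pt z (G z) \<or> p = pt z (F z)"
    by (auto simp: carrier_eq)
  obtain s t where st: "1/2 \<le> s" "s < t" "t \<le> 1" "sweep l r ` {s..t} = {l..r}"
    using sweep_interval[OF less order_refl less order_refl] .
  then have "z \<in> sweep l r ` {s..t}"
    using z(1) by simp
  then obtain a where a: "sweep l r a = z" "1/2 \<le> a" "a \<le> 1"
    using st(1,3) by auto
  have "circle a = pt z (G z)" "circle (1 - a) = pt z (F z)"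
    using a diamond_y_sign circle_lower[of a] circle_upper[of "1 - a"] by (auto simp: sweep_reflect)
  then show "p \<in> range circle" using z(2) by (metis rangeI)
qed

end

lemma link_diagram_UN:
  assumes "finite K" "K \<noteq> {}" "\<And>k. k \<in> K \<Longrightarrow> link_diagram (E k)"
    and disj: "\<And>j k. j \<in> K \<Longrightarrow> k \<in> K \<Longrightarrow> j \<noteq> k \<Longrightarrow> disjnt (fst ` carrier_of (E j)) (fst ` carrier_of (E k))"
  shows "link_diagram (\<Union>k\<in>K. E k)"
proof -
  have carrier: "carrier_of (\<Union>k\<in>K. E k) = (\<Union>k\<in>K. carrier_of (E k))"
    by (auto simp: carrier_of_def)
  have same: "j = k" if "p \<in> carrier_of (E j)" "q \<in> carrier_of (E k)" "fst p = fst q" "j \<in> K" "k \<in> K" for p q j k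
    using disj[OF that(4,5)] that(1-3) unfolding disjnt_def by (metis IntI empty_iff image_eqI)
  have seg: "p \<in> carrier_of (E k)" if "(u, v) \<in> E k" "p \<in> closed_segment u v" for p u v k
    using that unfolding carrier_of_def by auto
  have poly: "polygonal_link (E k)" and reg: "regular_projection (E k)" if "k \<in> K" for k
    using assms(3)[OF that] by (auto simp: link_diagram_def)
  have "polygonal_link (\<Union>k\<in>K. E k)"
    unfolding polygonal_link_def
  proof (intro conjI)
    show "finite (\<Union>k\<in>K. E k)" "(\<Union>k\<in>K. E k) \<noteq> {}"
      using assms(1,2) poly by (simp_all add: polygonal_link_def)
    show "\<forall>(u, v)\<in>\<Union>k\<in>K. E k. u \<noteq> v \<and> (\<exists>!w. (v, w) \<in> (\<Union>k\<in>K. E k)) \<and> (\<exists>!w. (w, u) \<in> (\<Union>k\<in>K. E k))"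
    proof (intro ballI case_prodI2)
      fix e u v
      assume "e \<in> (\<Union>k\<in>K. E k)" "e = (u, v)"
      then obtain k where k: "k \<in> K" and uv: "(u, v) \<in> E k" by auto
      have "\<forall>(u, v)\<in>E k. u \<noteq> v \<and> (\<exists>!w. (v, w) \<in> E k) \<and> (\<exists>!w. (w, u) \<in> E k)"
        using poly[OF k] unfolding polygonal_link_def by (elim conjE)
      then have "u \<noteq> v \<and> (\<exists>!w. (v, w) \<in> E k) \<and> (\<exists>!w. (w, u) \<in> E k)"
        using uv by fast
      moreover have only: "j = k" if "j \<in> K" "(v, w) \<in> E j \<or> (w, u) \<in> E j" for j w
      proof -
        have "v \<in> carrier_of (E j) \<or> u \<in> carrier_of (E j)" "v \<in> carrier_of (E k)" "u \<in> carrier_of (E k)"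
          using that(2) seg uv by (meson ends_in_segment)+
        then show ?thesis using same that(1) k by blast
      qed
      have "(v, w) \<in> (\<Union>k\<in>K. E k) \<longleftrightarrow> (v, w) \<in> E k" "(w, u) \<in> (\<Union>k\<in>K. E k) \<longleftrightarrow> (w, u) \<in> E k" for w
        using only k by blast+
      ultimately show "u \<noteq> v \<and> (\<exists>!w. (v, w) \<in> (\<Union>k\<in>K. E k)) \<and> (\<exists>!w. (w, u) \<in> (\<Union>k\<in>K. E k))"
        by simp
    qed
    have "closed_segment u v \<inter> closed_segment u' v' \<subseteq> {u, v} \<inter> {u', v'}"
      if "j \<in> K" "(u, v) \<in> E j" "k \<in> K" "(u', v') \<in> E k" "(u, v) \<noteq> (u', v')" for j k u v u' v'
    proof (cases "j = k")
      case True
      have "\<forall>(u, v)\<in>E j. \<forall>(u', v')\<in>E j. (u, v) \<noteq> (u', v') \<longrightarrow>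
        closed_segment u v \<inter> closed_segment u' v' \<subseteq> {u, v} \<inter> {u', v'}"
        using poly[OF that(1)] unfolding polygonal_link_def by (elim conjE)
      then show ?thesis using that True by blast
    next
      case False
      then show ?thesis using same seg that by blast
    qed
    then show "\<forall>(u, v)\<in>\<Union>k\<in>K. E k. \<forall>(u', v')\<in>\<Union>k\<in>K. E k. (u, v) \<noteq> (u', v') \<longrightarrow>
        closed_segment u v \<inter> closed_segment u' v' \<subseteq> {u, v} \<inter> {u', v'}"
      by blast
  qed
  moreover have "regular_projection (\<Union>k\<in>K. E k)"
    unfolding regular_projection_def carrier
  proof (intro conjI allI)
    let ?D = "\<lambda>k. {x. \<exists>p\<in>carrier_of (E k). \<exists>q\<in>carrier_of (E k). p \<noteq> q \<and> fst p = x \<and> fst q = x}"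
    have "finite (\<Union>k\<in>K. ?D k)"
      using assms(1) reg unfolding regular_projection_def by blast
    moreover have "{x. \<exists>p\<in>\<Union>k\<in>K. carrier_of (E k). \<exists>q\<in>\<Union>k\<in>K. carrier_of (E k). p \<noteq> q \<and> fst p = x \<and> fst q = x} \<subseteq> (\<Union>k\<in>K. ?D k)"
    proof (intro subsetI, elim CollectE bexE conjE UN_E)
      fix x p q j k
      assume *: "j \<in> K" "p \<in> carrier_of (E j)" "k \<in> K" "q \<in> carrier_of (E k)" "p \<noteq> q" "fst p = x" "fst q = x"
      then have "j = k" using same[of p j q k] by simp
      with * show "x \<in> (\<Union>k\<in>K. ?D k)"
        by blast
    qed
    ultimately show "finite {x. \<exists>p\<in>\<Union>k\<in>K. carrier_of (E k). \<exists>q\<in>\<Union>k\<in>K. carrier_of (E k). p \<noteq> q \<and> fst p = x \<and> fst q = x}"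
      by (rule rev_finite_subset)
  next
    fix x
    show "card {p \<in> \<Union>k\<in>K. carrier_of (E k). fst p = x} \<le> 2"
    proof (cases "\<exists>k\<in>K. \<exists>p\<in>carrier_of (E k). fst p = x")
      case True
      then obtain k p where k: "k \<in> K" "p \<in> carrier_of (E k)" "fst p = x" by blast
      have "{p \<in> \<Union>k\<in>K. carrier_of (E k). fst p = x} = {p \<in> carrier_of (E k). fst p = x}"
      proof (intro equalityI subsetI; elim CollectE conjE UN_E; intro CollectI conjI)
        fix q j
        assume "j \<in> K" "q \<in> carrier_of (E j)" "fst q = x"
        then show "q \<in> carrier_of (E k)"
          using same[of q j p k] k by simp
      qed (use k(1) in blast)+
      then show ?thesis using reg[OF k(1)] unfolding regular_projection_def by simp
    next
      case False
      then have "{p \<in> \<Union>k\<in>K. carrier_of (E k). fst p = x} = {}" by blast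
      then show ?thesis by (metis card.empty zero_le)
    qed
  next
    have "p = u" if "j \<in> K" "(u, v) \<in> E j" "k \<in> K" "p \<in> carrier_of (E k)" "fst p = fst u" for j k u v p
    proof -
      have "k = j" using same[OF that(4) seg[OF that(2)] that(5)] that by auto
      then show ?thesis using reg[OF that(1)] that unfolding regular_projection_def by blast
    qed
    then show "\<forall>(u, v)\<in>\<Union>k\<in>K. E k. \<forall>p\<in>\<Union>k\<in>K. carrier_of (E k). fst p = fst u \<longrightarrow> p = u"
      by blast
  qed
  ultimately show ?thesis by (simp add: link_diagram_def)
qed

definition bigon_family :: "nat set \<Rightarrow> (nat \<Rightarrow> real) \<Rightarrow> (nat \<Rightarrow> real) \<Rightarrow> (nat \<Rightarrow> real set) \<Rightarrow> (nat \<Rightarrow> real \<Rightarrow> complex)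
    \<Rightarrow> (nat \<Rightarrow> real set) \<Rightarrow> (nat \<Rightarrow> real \<Rightarrow> complex) \<Rightarrow> bool" where
  "bigon_family K l r X F Y G \<longleftrightarrow> finite K \<and> K \<noteq> {} \<and>
     (\<forall>k\<in>K. bigon (l k) (r k) (X k) (F k) (Y k) (G k)) \<and>
     (\<forall>j\<in>K. \<forall>k\<in>K. j < k \<longrightarrow> r j < l k)"

lemma bigon_family_link:
  assumes "bigon_family K l r X F Y G"
  shows "link_diagram (\<Union>k\<in>K. bigon_edges (X k) (F k) (Y k) (G k))"
    and "traverses ((\<lambda>k. bigon_circle (l k) (r k) (F k) (G k)) ` K) (\<Union>k\<in>K. bigon_edges (X k) (F k) (Y k) (G k))"
proof -
  let ?E = "\<lambda>k. bigon_edges (X k) (F k) (Y k) (G k)" and ?c = "\<lambda>k. bigon_circle (l k) (r k) (F k) (G k)"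
  have K: "finite K" "K \<noteq> {}" and bigon: "\<And>k. k \<in> K \<Longrightarrow> bigon (l k) (r k) (X k) (F k) (Y k) (G k)"
    and order: "\<And>j k. j \<in> K \<Longrightarrow> k \<in> K \<Longrightarrow> j < k \<Longrightarrow> r j < l k"
    using assms by (auto simp: bigon_family_def)
  have disj: "disjnt (fst ` carrier_of (?E j)) (fst ` carrier_of (?E k))" if "j \<in> K" "k \<in> K" "j \<noteq> k" for j k
  proof -
    have "fst p \<noteq> fst q" if "p \<in> carrier_of (?E j)" "q \<in> carrier_of (?E k)" for p q
      using bigon.carrier_range[OF bigon[OF \<open>j \<in> K\<close>] that(1)] bigon.carrier_range[OF bigon[OF \<open>k \<in> K\<close>] that(2)]
        order[of j k] order[of k j] \<open>j \<in> K\<close> \<open>k \<in> K\<close> \<open>j \<noteq> k\<close> by (cases j k rule: linorder_cases) auto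
    then show ?thesis unfolding disjnt_def by blast
  qed
  show "link_diagram (\<Union>k\<in>K. ?E k)"
    using K disj bigon.polygonal[OF bigon] bigon.regular[OF bigon]
    by (intro link_diagram_UN) (auto simp: link_diagram_def)
  have ranges: "range (?c k) = carrier_of (?E k)" if "k \<in> K" for k
    by (rule bigon.range_circle[OF bigon[OF that]])
  show "traverses (?c ` K) (\<Union>k\<in>K. ?E k)"
    unfolding traverses_def oriented_circles_def
  proof (intro conjI)
    show "finite (?c ` K)" "?c ` K \<noteq> {}" using K by auto
    show "\<forall>\<gamma>\<in>?c ` K. embedded_circle \<gamma>"
      using bigon.embedded[OF bigon] by blast
    have "disjnt (range (?c j)) (range (?c k))" if "j \<in> K" "k \<in> K" "j \<noteq> k" for j k
      using disj[OF that] unfolding ranges[OF that(1)] ranges[OF that(2)] disjnt_def by blast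
    then show "pairwise (\<lambda>\<gamma> \<delta>. disjnt (range \<gamma>) (range \<delta>)) (?c ` K)"
      by (intro pairwise_imageI) auto
    show "(\<Union>\<gamma>\<in>?c ` K. range \<gamma>) = carrier_of (\<Union>k\<in>K. ?E k)"
    proof -
      have "carrier_of (\<Union>k\<in>K. ?E k) = (\<Union>k\<in>K. carrier_of (?E k))"
        by (auto simp: carrier_of_def)
      then show ?thesis using ranges by auto
    qed
    show "\<forall>(u, v)\<in>\<Union>k\<in>K. ?E k. \<exists>\<gamma>\<in>?c ` K. \<exists>s t. s < t \<and> t < s + 1 \<and> \<gamma> s = u \<and> \<gamma> t = v \<and> \<gamma> ` {s..t} = closed_segment u v"
    proof (intro ballI case_prodI2)
      fix e u v
      assume "e \<in> (\<Union>k\<in>K. ?E k)" "e = (u, v)"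
      then obtain k where k: "k \<in> K" and uv: "(u, v) \<in> ?E k" by auto
      show "\<exists>\<gamma>\<in>?c ` K. \<exists>s t. s < t \<and> t < s + 1 \<and> \<gamma> s = u \<and> \<gamma> t = v \<and> \<gamma> ` {s..t} = closed_segment u v"
        by (rule bexI[of _ "?c k"], rule bigon.traverse_edge[OF bigon[OF k] uv]) (use k in blast)
    qed
  qed
qed

section \<open>A skein triple of round unlinks\<close>

text \<open>Exchanging the two graphs reverses the orientation.\<close>

lemma bigon_swap: "bigon l r X F Y G \<Longrightarrow> bigon l r Y G X F"
  unfolding bigon_def by (auto simp: eq_commute)

definition hat :: "nat \<Rightarrow> real \<Rightarrow> complex" where
  "hat k x = of_real (1 - \<bar>x - 3 * real k\<bar>)"

definition hat_knots :: "nat \<Rightarrow> real set" where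
  "hat_knots k = {3 * real k - 1, 3 * real k, 3 * real k + 1}"

lemma consecutive_hat_knots [simp]:
  "consecutive (hat_knots k) = {(3 * real k - 1, 3 * real k), (3 * real k, 3 * real k + 1)}"
  by (simp add: hat_knots_def)

text \<open>The diamond with centre \<open>3 k\<close>, counterclockwise.\<close>

lemma bigon_diamond:
  "bigon (3 * real k - 1) (3 * real k + 1) (hat_knots k) (hat k) (hat_knots k) (\<lambda>x. - hat k x)"
proof
  show "continuous_on {3 * real k - 1..3 * real k + 1} (hat k)"
    "continuous_on {3 * real k - 1..3 * real k + 1} (\<lambda>x. - hat k x)"
    unfolding hat_def by (intro continuous_intros)+
  show "affine_between (hat k) x y" "affine_between (\<lambda>x. - hat k x) x y"
    if "(x, y) \<in> consecutive (hat_knots k)" for x y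
    using that by (auto simp: affine_between_def complex_eq_iff hat_def)
  have "{x \<in> {3 * real k - 1..3 * real k + 1}. Re (hat k x) = Re (- hat k x)} \<subseteq> {3 * real k - 1, 3 * real k + 1}"
    by (auto simp: hat_def abs_if split: if_splits)
  then show "finite {x \<in> {3 * real k - 1..3 * real k + 1}. Re (hat k x) = Re (- hat k x)}"
    by (rule finite_subset) simp
qed (auto simp: hat_knots_def hat_def complex_eq_iff abs_if split: if_splits)

lemma circle_diamond:
  "bigon_circle (3 * real k - 1) (3 * real k + 1) (hat k) (\<lambda>x. - hat k x) t = pt (3 * real k + diamond_x t) (of_real (diamond_y t))"
  "bigon_circle (3 * real k - 1) (3 * real k + 1) (\<lambda>x. - hat k x) (hat k) t = pt (3 * real k + diamond_x t) (- of_real (diamond_y t))"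
  using diamond_abs[of t]
  by (auto simp: bigon_circle_def sweep_def hat_def abs_if complex_eq_iff split: if_splits)

text \<open>The coordinates of the diamond are the signed squares of those of the circle, which \<open>bulge\<close> undoes.\<close>

lemma rounding_isotopy:
  obtains h where "space_isotopy h"
    "\<And>k t. k < r \<Longrightarrow> h 1 (pt (3 * real k + diamond_x t) (of_real (diamond_y t))) = (cis (2 * pi * t) + 3 * of_nat k, 0)"
proof -
  let ?h = "\<lambda>t p. (Complex ((1 - t) * Re (fst p) + t * bulges r (Re (fst p))) ((1 - t) * Im (fst p) + t * bulge (Im (fst p))), snd p)"
  have "space_isotopy ?h"
    by (rule space_isotopy_coordinatewise[OF line_map_bulges line_map_bulge])
  moreover have "?h 1 (pt (3 * real k + diamond_x t) (of_real (diamond_y t))) = (cis (2 * pi * t) + 3 * of_nat k, 0)"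
    if "k < r" for k t
  proof -
    have "\<bar>diamond_x t\<bar> \<le> 1" using diamond_abs[of t] by linarith
    then have "bulges r (3 * real k + diamond_x t) = 3 * real k + cos (2 * pi * t)"
      using bulges_at that bulge_square[of "cos (2 * pi * t)"] by (simp add: diamond_x_def)
    moreover have "bulge (diamond_y t) = sin (2 * pi * t)"
      using bulge_square[of "sin (2 * pi * t)"] by (simp add: diamond_y_def)
    ultimately show ?thesis by (simp add: pt_def complex_eq_iff)
  qed
  ultimately show thesis using that by blast
qed

text \<open>The \<open>y\<close>-coordinate of the strand of the figure eight that runs to the right: the piecewise linear
  function through \<open>(-1, 0), (0, -1), (2, 0), (3, 1), (4, 0)\<close>. The other strand is its mirror image
  under \<open>x \<mapsto> 3 - x\<close>.\<close>

definition zigzag :: "real \<Rightarrow> real" where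
  "zigzag x = 3/2 - x + 3/4 * \<bar>x\<bar> + 1/4 * \<bar>x - 2\<bar> - \<bar>x - 3\<bar>"

text \<open>The height profile of the strand from \<open>a\<close> to \<open>b\<close>: it rises from \<open>a\<close> at \<open>x = 0\<close> to \<open>p\<close> at \<open>x = 1\<close>, stays at
  height \<open>1\<close> until \<open>q\<close> at \<open>x = 7/4\<close> and returns to \<open>0\<close> at \<open>b\<close>, where \<open>x = 2\<close>.\<close>

definition bump :: "real \<Rightarrow> real" where
  "bump x = max 0 (min x (min 1 (8 - 4 * x)))"

text \<open>The sign of \<open>\<epsilon>\<close> decides whether this strand passes above or below the other one at the crossing over
  \<open>x = 3/2\<close>.\<close>

definition strand_ab :: "real \<Rightarrow> real \<Rightarrow> complex" where
  "strand_ab \<epsilon> x = Complex (zigzag x) (\<epsilon> * bump x)"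

definition strand_cd :: "real \<Rightarrow> complex" where
  "strand_cd x = of_real (zigzag (3 - x))"

lemma zigzag_pieces:
  "x \<le> 0 \<Longrightarrow> zigzag x = -1 - x"
  "0 \<le> x \<Longrightarrow> x \<le> 2 \<Longrightarrow> zigzag x = x / 2 - 1"
  "2 \<le> x \<Longrightarrow> x \<le> 3 \<Longrightarrow> zigzag x = x - 2"
  "3 \<le> x \<Longrightarrow> zigzag x = 4 - x"
  by (simp_all add: zigzag_def abs_if field_simps)

lemma bump_pieces:
  "x \<le> 0 \<Longrightarrow> bump x = 0"
  "0 \<le> x \<Longrightarrow> x \<le> 1 \<Longrightarrow> bump x = x"
  "1 \<le> x \<Longrightarrow> x \<le> 7/4 \<Longrightarrow> bump x = 1"
  "7/4 \<le> x \<Longrightarrow> x \<le> 2 \<Longrightarrow> bump x = 8 - 4 * x"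
  "2 \<le> x \<Longrightarrow> bump x = 0"
  by (auto simp: bump_def max_def min_def)

lemma zigzag_equal: "-1 < x \<Longrightarrow> x < 4 \<Longrightarrow> zigzag (3 - x) = zigzag x \<Longrightarrow> x = 3/2"
  by (simp add: zigzag_def abs_if field_simps split: if_splits)

lemma bigon_figure_eight:
  assumes "\<epsilon> \<noteq> 0"
  shows "bigon (-1) 4 {-1, 0, 1, 3, 4} strand_cd {-1, 0, 1, 7/4, 2, 3, 4} (strand_ab \<epsilon>)"
proof
  show "continuous_on {-1..4} strand_cd" "continuous_on {-1..4} (strand_ab \<epsilon>)"
    unfolding strand_cd_def strand_ab_def zigzag_def bump_def by (intro continuous_intros)+
  show "affine_between strand_cd x y" if "(x, y) \<in> consecutive {-1, 0, 1, 3, 4}" for x y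
    using that by (auto simp: affine_between_def complex_eq_iff strand_cd_def zigzag_pieces field_simps)
  show "affine_between (strand_ab \<epsilon>) x y" if "(x, y) \<in> consecutive {-1, 0, 1, 7/4, 2, 3, 4}" for x y
    using that by (auto simp: affine_between_def complex_eq_iff strand_ab_def zigzag_pieces bump_pieces field_simps)
  have bump: "bump (3/2) = 1" by (simp add: bump_def)
  show "strand_cd x \<noteq> strand_ab \<epsilon> x" if "-1 < x" "x < 4" for x
  proof
    assume "strand_cd x = strand_ab \<epsilon> x"
    then have "zigzag (3 - x) = zigzag x" "\<epsilon> * bump x = 0"
      by (auto simp: strand_cd_def strand_ab_def complex_eq_iff)
    then have "bump (3/2) = 0"
      using zigzag_equal[OF that] assms by (metis mult_eq_0_iff)
    with bump show False by simp
  qed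
  have "{x \<in> {-1..4}. Re (strand_cd x) = Re (strand_ab \<epsilon> x)} \<subseteq> {-1, 3/2, 4}"
    using zigzag_equal by (force simp: strand_cd_def strand_ab_def)
  then show "finite {x \<in> {-1..4}. Re (strand_cd x) = Re (strand_ab \<epsilon> x)}"
    by (rule finite_subset) simp
qed (auto simp: strand_cd_def strand_ab_def zigzag_pieces bump_pieces complex_eq_iff)

text \<open>Contracts \<open>[-1, 4]\<close> to \<open>[-1, 1]\<close> and moves everything beyond \<open>4\<close> to the left by \<open>3\<close>, which closes the gap left by
  the second lobe of the figure eight.\<close>

lemma line_map_squeeze: "line_map (\<lambda>x::real. max (x - 3) (min x ((2 * x - 3) / 5))) 3"
  unfolding line_map_def
proof (intro conjI allI)
  show "continuous_on UNIV (\<lambda>x::real. max (x - 3) (min x ((2 * x - 3) / 5)))"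
    by (intro continuous_intros) auto
  show "strict_mono (\<lambda>x::real. max (x - 3) (min x ((2 * x - 3) / 5)))"
    by (rule strict_monoI) (auto simp: max_def min_def)
  show "\<bar>max (x - 3) (min x ((2 * x - 3) / 5)) - x\<bar> \<le> 3" for x :: real
    by (auto simp: max_def min_def)
qed

lemma line_map_id: "line_map (\<lambda>x. x) 0"
  by (auto simp: line_map_def strict_mono_def)

text \<open>Let \<open>C(x)\<close> be the midpoint and \<open>V(x)\<close> half the difference of the two points over \<open>x\<close>. The
  isotopy moves \<open>C(x)\<close> to \<open>0\<close> and multiplies by \<open>A(x)\<close>, where \<open>A(x) V(x)\<close> is the real number
  \<open>tent(x)\<close>; the image is a diamond stretched to \<open>[-1, 4]\<close>, which is then squeezed. Near both ends \<open>V\<close> and the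
  tent are proportional. Hence their quotient is constant there, and it extends
  continuously to the ends, where both vanish. The sign of \<open>\<epsilon>\<close> only determines on which
  side \<open>V\<close> passes the origin, so the same argument serves both crossings.\<close>

lemma flattening_isotopy:
  assumes "\<epsilon> \<noteq> 0"
  obtains h where "space_isotopy h"
    "\<And>t. h 1 (bigon_circle (-1) 4 strand_cd (strand_ab \<epsilon>) t) = pt (diamond_x t) (of_real (diamond_y t))"
    "\<And>x w. 5 \<le> x \<Longrightarrow> h 1 (pt x w) = pt (x - 3) w"
proof -
  interpret bigon "-1" 4 "{-1, 0, 1, 3, 4}" strand_cd "{-1, 0, 1, 7/4, 2, 3, 4}" "strand_ab \<epsilon>"
    by (rule bigon_figure_eight[OF assms])
  \<comment> \<open>At \<open>x = 0\<close> the ratio of \<open>V\<close> and the tent is already that at the end \<open>-1\<close>, and likewise for \<open>3\<close> and \<open>4\<close>; so \<open>A\<close> is evaluated at the nearest point of \<open>[0, 3]\<close>.\<close>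
  define V where "V x = (strand_cd x - strand_ab \<epsilon> x) / 2" for x
  define C where "C x = (strand_cd x + strand_ab \<epsilon> x) / 2" for x
  define tent where "tent x = 1 - \<bar>(2 * x - 3) / 5\<bar>" for x :: real
  define clip where "clip x = max 0 (min 3 x)" for x :: real
  define A where "A x = of_real (tent (clip x)) / V (clip x)" for x
  have clip: "clip x \<in> {0..3}" for x by (auto simp: clip_def)
  have V: "V x \<noteq> 0" and tent: "tent x > 0" if "x \<in> {0..3}" for x
    using that distinct[of x] by (auto simp: V_def tent_def abs_if)
  have A_V: "A x * V x = of_real (tent x)" if "x \<in> {-1..4}" for x
  proof -
    consider "x \<in> {0..3}" | "x \<in> {-1..0}" | "x \<in> {3..4}"
      using \<open>x \<in> {-1..4}\<close> by fastforce
    then show ?thesis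
    proof cases
      case 1
      then have "clip x = x" by (auto simp: clip_def)
      then show ?thesis using V[OF 1] by (simp add: A_def)
    next
      case 2
      then have *: "clip x = 0" "V 0 = 1" "V x = of_real (1 + x)" "tent 0 = 2/5" "tent x = 2/5 * (1 + x)"
        by (auto simp: clip_def V_def tent_def strand_cd_def strand_ab_def zigzag_pieces bump_pieces complex_eq_iff abs_if field_simps)
      show ?thesis by (simp only: A_def *) (simp add: field_simps)
    next
      case 3
      then have *: "clip x = 3" "V 3 = -1" "V x = - of_real (4 - x)" "tent 3 = 2/5" "tent x = 2/5 * (4 - x)"
        by (auto simp: clip_def V_def tent_def strand_cd_def strand_ab_def zigzag_pieces bump_pieces complex_eq_iff abs_if field_simps)
      show ?thesis by (simp only: A_def *) (simp add: field_simps)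
    qed
  qed
  have "continuous_on {-1..4} C"
    unfolding C_def by (intro continuous_intros cont) auto
  moreover have "continuous_on {-1..4} A"
  proof -
    have clip_cont: "continuous_on {-1..4} clip"
      unfolding clip_def by (intro continuous_intros)
    have "continuous_on {-1..4} (\<lambda>x. V (clip x))"
      unfolding V_def
      by (intro continuous_intros continuous_on_compose2[OF cont(1) clip_cont] continuous_on_compose2[OF cont(2) clip_cont])
         (auto simp: clip_def)
    then show ?thesis
      unfolding A_def tent_def using V[OF clip] by (intro continuous_intros clip_cont) auto
  qed
  moreover have "A x \<noteq> 0" for x
    using V[OF clip] tent[OF clip] by (auto simp: A_def) (metis less_irrefl)
  ultimately obtain h where h: "space_isotopy h"
    "\<And>x w. x \<in> {-1..4} \<Longrightarrow> h 1 (pt x w) = pt x (A x * (w - C x))"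
    "\<And>x w. x \<le> -1 - 1 \<or> 4 + 1 \<le> x \<Longrightarrow> h 1 (pt x w) = pt x w"
    using slice_isotopy_exists[of "-1" 4 A C] by auto
  define k where "k t p = (Complex ((1 - t) * Re (fst p) + t * max (Re (fst p) - 3) (min (Re (fst p)) ((2 * Re (fst p) - 3) / 5)))
      ((1 - t) * Im (fst p) + t * Im (fst p)), snd p)" for t and p :: space3
  have k: "space_isotopy k"
    unfolding k_def by (rule space_isotopy_coordinatewise[OF line_map_squeeze line_map_id])
  have k1: "k 1 (pt x w) = pt (max (x - 3) (min x ((2 * x - 3) / 5))) w" for x w
    by (simp add: k_def pt_def)
  have "space_isotopy (\<lambda>t. k t \<circ> h t)"
    by (rule space_isotopy_compose[OF h(1) k])
  moreover have "(k 1 \<circ> h 1) (circle t) = pt (diamond_x t) (of_real (diamond_y t))" for t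
  proof -
    define x where "x = sweep (-1) 4 t"
    have x: "x \<in> {-1..4}" unfolding x_def by (rule sweep_range)
    have dx: "(2 * x - 3) / 5 = diamond_x t" by (simp add: x_def sweep_def field_simps)
    have tent_x: "tent x = \<bar>diamond_y t\<bar>" using diamond_abs[of t] by (simp add: tent_def dx)
    have "strand_cd x - C x = V x" "strand_ab \<epsilon> x - C x = - V x"
      by (simp_all add: V_def C_def field_simps)
    then have "h 1 (pt x (strand_cd x)) = pt x (of_real \<bar>diamond_y t\<bar>)" "h 1 (pt x (strand_ab \<epsilon> x)) = pt x (- of_real \<bar>diamond_y t\<bar>)"
      using h(2)[OF x] A_V[OF x] tent_x by simp_all
    then have "h 1 (circle t) = pt x (of_real (diamond_y t))"
      using circle_lower[of t] circle_upper[of t] by (cases "diamond_y t \<le> 0") (auto simp: x_def)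
    moreover have "max (x - 3) (min x ((2 * x - 3) / 5)) = (2 * x - 3) / 5"
      using x by (auto simp: max_def min_def)
    ultimately show ?thesis by (simp add: k1 dx)
  qed
  moreover have "(k 1 \<circ> h 1) (pt x w) = pt (x - 3) w" if "5 \<le> x" for x w
    using h(3)[of x w] that by (simp add: k1 max_def)
  ultimately show thesis using that by blast
qed

text \<open>The figure eight becomes the circle number \<open>0\<close> and the diamond number \<open>k \<ge> 2\<close> becomes the
  circle number \<open>k - 1\<close>.\<close>

lemma has_diagram_crossed:
  assumes "r \<ge> 1" "\<epsilon> \<noteq> 0"
  shows "has_diagram (round_unlink r) (bigon_edges {-1, 0, 1, 3, 4} strand_cd {-1, 0, 1, 7/4, 2, 3, 4} (strand_ab \<epsilon>)
    \<union> (\<Union>k\<in>{2..r}. bigon_edges (hat_knots k) (hat k) (hat_knots k) (\<lambda>x. - hat k x)))"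
proof -
  define K where "K = Suc ` {..<r}"
  define l where "l k = (if k = 1 then -1 else 3 * real k - 1)" for k
  define u where "u k = (if k = 1 then 4 else 3 * real k + 1)" for k
  define X where "X k = (if k = 1 then {-1, 0, 1, 3, 4} else hat_knots k)" for k
  define Y where "Y k = (if k = 1 then {-1, 0, 1, 7/4, 2, 3, 4} else hat_knots k)" for k
  define F where "F k = (if k = 1 then strand_cd else hat k)" for k
  define G where "G k = (if k = 1 then strand_ab \<epsilon> else (\<lambda>x. - hat k x))" for k
  have "bigon_family K l u X F Y G"
    unfolding bigon_family_def
  proof (intro conjI ballI impI)
    show "finite K" "K \<noteq> {}" using assms(1) by (auto simp: K_def lessThan_empty_iff bot_nat_def)
    show "bigon (l k) (u k) (X k) (F k) (Y k) (G k)" for k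
      using bigon_figure_eight[OF assms(2)] bigon_diamond by (simp add: l_def u_def X_def Y_def F_def G_def)
    show "u j < l k" if "j \<in> K" "k \<in> K" "j < k" for j k
      using that by (auto simp: K_def u_def l_def)
  qed
  note family = bigon_family_link[OF this]
  obtain h where h: "space_isotopy h"
    "\<And>t. h 1 (bigon_circle (-1) 4 strand_cd (strand_ab \<epsilon>) t) = pt (diamond_x t) (of_real (diamond_y t))"
    "\<And>x w. 5 \<le> x \<Longrightarrow> h 1 (pt x w) = pt (x - 3) w"
    using flattening_isotopy[OF assms(2)] by metis
  obtain g where g: "space_isotopy g"
    "\<And>k t. k < r \<Longrightarrow> g 1 (pt (3 * real k + diamond_x t) (of_real (diamond_y t))) = (cis (2 * pi * t) + 3 * of_nat k, 0)"
    using rounding_isotopy[of r] by metis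
  have "h 1 (bigon_circle (l (Suc j)) (u (Suc j)) (F (Suc j)) (G (Suc j)) t) = pt (3 * real j + diamond_x t) (of_real (diamond_y t))" for j t
  proof (cases "j = 0")
    case True
    then show ?thesis using h(2) by (simp add: l_def u_def F_def G_def)
  next
    case False
    have "3 * 2 \<le> 3 * real (Suc j)" by (rule mult_left_mono) (use False in simp_all)
    moreover have "-1 \<le> diamond_x t" using diamond_abs[of t] by linarith
    ultimately have "3 * 2 + (-1) \<le> 3 * real (Suc j) + diamond_x t" by (rule add_mono)
    then have "5 \<le> 3 * real (Suc j) + diamond_x t" by simp
    then show ?thesis
      using False h(3) circle_diamond(1)[of "Suc j" t] by (simp add: l_def u_def F_def G_def)
  qed
  then have "(g 1 \<circ> h 1) \<circ> bigon_circle (l (Suc j)) (u (Suc j)) (F (Suc j)) (G (Suc j)) = (\<lambda>t. (cis (2 * pi * t) + 3 * of_nat j, 0))" if "j < r" for j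
    using g(2)[OF that] by (simp add: fun_eq_iff)
  then have "(\<lambda>\<gamma>. stereo \<circ> ((g 1 \<circ> h 1) \<circ> \<gamma>)) ` ((\<lambda>k. bigon_circle (l k) (u k) (F k) (G k)) ` K) = round_unlink r"
    unfolding round_unlink_def K_def image_image by (intro image_cong refl) (simp add: o_def)
  then have "has_diagram (round_unlink r) (\<Union>k\<in>K. bigon_edges (X k) (F k) (Y k) (G k))"
    using has_diagram_space_isotopy[OF family space_isotopy_compose[OF h(1) g(1)]] by simp
  moreover have "K = insert 1 {2..r}"
    using assms(1) by (auto simp: K_def image_Suc_lessThan)
  ultimately show ?thesis
    by (simp add: X_def Y_def F_def G_def)
qed

text \<open>The two parts of the smoothed figure eight are oppositely oriented. A half turn about the \<open>x\<close>-axis,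
  which is multiplication by \<open>-1\<close> in the planes over \<open>[2, 4]\<close>, corrects the second one.\<close>

lemma has_diagram_smoothed:
  assumes "r \<ge> 1"
  shows "has_diagram (round_unlink (Suc r)) (bigon_edges (hat_knots 0) (hat 0) (hat_knots 0) (\<lambda>x. - hat 0 x)
    \<union> bigon_edges (hat_knots 1) (\<lambda>x. - hat 1 x) (hat_knots 1) (hat 1)
    \<union> (\<Union>k\<in>{2..r}. bigon_edges (hat_knots k) (hat k) (hat_knots k) (\<lambda>x. - hat k x)))"
proof -
  define F where "F k = (if k = 1 then (\<lambda>x. - hat k x) else hat k)" for k
  define G where "G k = (if k = 1 then hat k else (\<lambda>x. - hat k x))" for k
  have "bigon_family {..<Suc r} (\<lambda>k. 3 * real k - 1) (\<lambda>k. 3 * real k + 1) hat_knots F hat_knots G"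
    using bigon_diamond bigon_swap[OF bigon_diamond[of 1]] by (auto simp: bigon_family_def F_def G_def)
  note family = bigon_family_link[OF this]
  obtain h where h: "space_isotopy h"
    "\<And>x w. x \<in> {2..4} \<Longrightarrow> h 1 (pt x w) = pt x (-1 * (w - 0))"
    "\<And>x w. x \<le> 2 - 1 \<or> 4 + 1 \<le> x \<Longrightarrow> h 1 (pt x w) = pt x w"
    using slice_isotopy_exists[of 2 4 "\<lambda>_. -1" "\<lambda>_. 0"] by (auto intro!: continuous_intros)
  obtain g where g: "space_isotopy g"
    "\<And>k t. k < Suc r \<Longrightarrow> g 1 (pt (3 * real k + diamond_x t) (of_real (diamond_y t))) = (cis (2 * pi * t) + 3 * of_nat k, 0)"
    using rounding_isotopy[of "Suc r"] by metis
  have "h 1 (bigon_circle (3 * real k - 1) (3 * real k + 1) (F k) (G k) t) = pt (3 * real k + diamond_x t) (of_real (diamond_y t))" for k t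
  proof -
    have dx: "-1 \<le> diamond_x t" "diamond_x t \<le> 1" using diamond_abs[of t] by linarith+
    consider "k = 0" | "k = 1" | "k \<ge> 2" by linarith
    then show ?thesis
    proof cases
      case 1
      then show ?thesis
        using dx circle_diamond(1)[of 0 t] h(3)[of "diamond_x t"] by (simp add: F_def G_def)
    next
      case 2
      then show ?thesis
        using dx circle_diamond(2)[of 1 t] h(2)[of "3 + diamond_x t"] by (simp add: F_def G_def)
    next
      case 3
      then have "5 \<le> 3 * real k + diamond_x t" using dx by linarith
      then show ?thesis
        using 3 circle_diamond(1)[of k t] h(3)[of "3 * real k + diamond_x t"] by (simp add: F_def G_def)
    qed
  qed
  then have "(g 1 \<circ> h 1) \<circ> bigon_circle (3 * real k - 1) (3 * real k + 1) (F k) (G k) = (\<lambda>t. (cis (2 * pi * t) + 3 * of_nat k, 0))" if "k < Suc r" for k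
    using g(2)[OF that] by (simp add: fun_eq_iff)
  then have "(\<lambda>\<gamma>. stereo \<circ> ((g 1 \<circ> h 1) \<circ> \<gamma>)) ` ((\<lambda>k. bigon_circle (3 * real k - 1) (3 * real k + 1) (F k) (G k)) ` {..<Suc r}) = round_unlink (Suc r)"
    unfolding round_unlink_def image_image by (intro image_cong refl) (simp add: o_def)
  then have "has_diagram (round_unlink (Suc r)) (\<Union>k\<in>{..<Suc r}. bigon_edges (hat_knots k) (F k) (hat_knots k) (G k))"
    using has_diagram_space_isotopy[OF family space_isotopy_compose[OF h(1) g(1)]] by simp
  moreover have "{..<Suc r} = insert 0 (insert 1 {2..r})"
    using assms by auto
  ultimately show ?thesis
    by (simp add: F_def G_def Un_assoc)
qed

lemma figure_eight_edges:
  "bigon_edges {-1, 0, 1, 3, 4} strand_cd {-1, 0, 1, 7/4, 2, 3, 4} (strand_ab \<epsilon>) =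
    {(pt (-1) 0, pt 0 (-1)), (pt 0 (-1), pt 1 (Complex (-1/2) \<epsilon>)), (pt 1 (Complex (-1/2) \<epsilon>), pt (7/4) (Complex (-1/8) \<epsilon>)),
     (pt (7/4) (Complex (-1/8) \<epsilon>), pt 2 0), (pt 2 0, pt 3 1), (pt 3 1, pt 4 0),
     (pt 4 0, pt 3 (-1)), (pt 3 (-1), pt 1 0), (pt 1 0, pt 0 1), (pt 0 1, pt (-1) 0)}"
proof -
  have "strand_ab \<epsilon> (-1) = 0" "strand_ab \<epsilon> 0 = -1" "strand_ab \<epsilon> 1 = Complex (-1/2) \<epsilon>"
    "strand_ab \<epsilon> (7/4) = Complex (-1/8) \<epsilon>" "strand_ab \<epsilon> 2 = 0" "strand_ab \<epsilon> 3 = 1" "strand_ab \<epsilon> 4 = 0"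
    "strand_cd (-1) = 0" "strand_cd 0 = 1" "strand_cd 1 = 0" "strand_cd 3 = -1" "strand_cd 4 = 0"
    by (simp_all add: strand_ab_def strand_cd_def zigzag_def bump_def complex_eq_iff)
  then show ?thesis
    by (auto simp: bigon_edges_def graph_edges_def)
qed

lemma smoothed_edges:
  "bigon_edges (hat_knots 0) (hat 0) (hat_knots 0) (\<lambda>x. - hat 0 x) =
    {(pt (-1) 0, pt 0 (-1)), (pt 0 (-1), pt 1 0), (pt 1 0, pt 0 1), (pt 0 1, pt (-1) 0)}"
  "bigon_edges (hat_knots 1) (\<lambda>x. - hat 1 x) (hat_knots 1) (hat 1) =
    {(pt 2 0, pt 3 1), (pt 3 1, pt 4 0), (pt 4 0, pt 3 (-1)), (pt 3 (-1), pt 2 0)}"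
  by (auto simp: bigon_edges_def graph_edges_def hat_def)

text \<open>The corners of the crossing form a trapezoid, given by its four sides.\<close>

lemma crossing_hull:
  "convex hull {Complex 0 (-1), Complex 2 0, Complex 3 (-1), Complex 1 0}
    \<subseteq> {z. -1 \<le> Im z \<and> Im z \<le> 0 \<and> Im z + 1 \<le> Re z \<and> Re z \<le> 2 - Im z}"
proof (rule hull_minimal)
  let ?T = "{z. -1 \<le> Im z \<and> Im z \<le> 0 \<and> Im z + 1 \<le> Re z \<and> Re z \<le> 2 - Im z}"
  have T: "?T = {z. \<i> \<bullet> z \<ge> -1} \<inter> {z. \<i> \<bullet> z \<le> 0} \<inter> {z. Complex 1 (-1) \<bullet> z \<ge> 1} \<inter> {z. Complex 1 1 \<bullet> z \<le> 2}"
    by (auto simp: inner_complex_def)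
  show "convex ?T"
    unfolding T by (intro convex_Int convex_halfspace_ge convex_halfspace_le)
qed auto

lemma in_segment_coordinates:
  assumes "z \<in> closed_segment (Complex a b) (Complex c d)"
  obtains u where "0 \<le> u" "u \<le> 1" "Re z = a + u * (c - a)" "Im z = b + u * (d - b)"
proof -
  obtain u where u: "0 \<le> u" "u \<le> 1" "z = (1 - u) *\<^sub>R Complex a b + u *\<^sub>R Complex c d"
    using assms by (auto simp: closed_segment_def)
  have "Re z = a + u * (c - a)" "Im z = b + u * (d - b)"
    unfolding u(3) by (simp_all add: algebra_simps)
  then show thesis using that u(1,2) by blast
qed

lemma fst_closed_segment: "closed_segment (fst u) (fst v) = fst ` closed_segment u v"
  by (rule closed_segment_linear_image) (rule linear_fst)

text \<open>The figure eight has its crossing over \<open>(3/2, -1/4)\<close> in the trapezoid \<open>a = (0, -1)\<close>, \<open>c = (3, -1)\<close>,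
  \<open>b = (2, 0)\<close>, \<open>d = (1, 0)\<close>. Its two slanted sides \<open>a d\<close> and \<open>c b\<close> are edges of the two diamonds.
  Changing the crossing reverses the sign of \<open>\<epsilon>\<close> and smoothing it leaves the two diamonds.\<close>

lemma skein_triple_unlink:
  assumes "r \<ge> 1"
  shows "skein_triple (round_unlink r) (round_unlink r) (round_unlink (Suc r))"
proof -
  define D where "D = (\<Union>k\<in>{2..r}. bigon_edges (hat_knots k) (hat k) (hat_knots k) (\<lambda>x. - hat k x))"
  define R where "R = {(pt (-1) 0, pt 0 (-1)), (pt 2 0, pt 3 1), (pt 3 1, pt 4 0), (pt 4 0, pt 3 (-1)),
      (pt 1 0, pt 0 1), (pt 0 1, pt (-1) 0)} \<union> D"
  let ?a = "pt 0 (-1)" and ?b = "pt 2 0" and ?c = "pt 3 (-1)" and ?d = "pt 1 0"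
  let ?p = "\<lambda>\<epsilon>. pt 1 (Complex (-1/2) \<epsilon>)" and ?q = "\<lambda>\<epsilon>. pt (7/4) (Complex (-1/8) \<epsilon>)"
  define Ex where "Ex \<epsilon> = R \<union> {(?a, ?p \<epsilon>), (?p \<epsilon>, ?q \<epsilon>), (?q \<epsilon>, ?b), (?c, ?d)}" for \<epsilon>
  define E0 where "E0 = R \<union> {(?a, ?d), (?c, ?b)}"
  have crossed: "has_diagram (round_unlink r) (Ex \<epsilon>)" if "\<epsilon> \<noteq> 0" for \<epsilon>
  proof -
    have "Ex \<epsilon> = bigon_edges {-1, 0, 1, 3, 4} strand_cd {-1, 0, 1, 7/4, 2, 3, 4} (strand_ab \<epsilon>) \<union> D"
      unfolding figure_eight_edges Ex_def R_def by blast
    then show ?thesis using has_diagram_crossed[OF assms that] by (simp add: D_def)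
  qed
  have smoothed: "has_diagram (round_unlink (Suc r)) E0"
  proof -
    have "E0 = bigon_edges (hat_knots 0) (hat 0) (hat_knots 0) (\<lambda>x. - hat 0 x)
        \<union> bigon_edges (hat_knots 1) (\<lambda>x. - hat 1 x) (hat_knots 1) (hat 1) \<union> D"
      unfolding smoothed_edges E0_def R_def by blast
    then show ?thesis using has_diagram_smoothed[OF assms] by (simp add: D_def)
  qed
  have corners: "fst ?a = Complex 0 (-1)" "fst ?b = Complex 2 0" "fst ?c = Complex 3 (-1)" "fst ?d = Complex 1 0"
    by (simp_all add: fst_pt)
  have outside: "closed_segment (fst u) (fst v) \<inter> convex hull {fst ?a, fst ?b, fst ?c, fst ?d} \<subseteq> {fst ?a, fst ?b, fst ?c, fst ?d}"
    if "(u, v) \<in> R" for u v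
  proof
    fix z
    assume z: "z \<in> closed_segment (fst u) (fst v) \<inter> convex hull {fst ?a, fst ?b, fst ?c, fst ?d}"
    then have hull: "-1 \<le> Im z" "Im z \<le> 0" "Im z + 1 \<le> Re z" "Re z \<le> 2 - Im z"
      using crossing_hull unfolding corners by auto
    show "z \<in> {fst ?a, fst ?b, fst ?c, fst ?d}"
    proof (cases "(u, v) \<in> D")
      case True
      then obtain k where k: "k \<ge> 2" "(u, v) \<in> bigon_edges (hat_knots k) (hat k) (hat_knots k) (\<lambda>x. - hat k x)"
        by (auto simp: D_def)
      obtain p where p: "p \<in> closed_segment u v" "z = fst p"
        using z by (auto simp: fst_closed_segment)
      then have "p \<in> carrier_of (bigon_edges (hat_knots k) (hat k) (hat_knots k) (\<lambda>x. - hat k x))"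
        using k(2) by (auto simp: carrier_of_def)
      then have "3 * real k - 1 \<le> Re z"
        using bigon.carrier_range[OF bigon_diamond] p(2) by auto
      then show ?thesis using k(1) hull by linarith
    next
      case False
      then have uv: "(u, v) \<in> {(pt (-1) 0, pt 0 (-1)), (pt 2 0, pt 3 1), (pt 3 1, pt 4 0), (pt 4 0, pt 3 (-1)),
          (pt 1 0, pt 0 1), (pt 0 1, pt (-1) 0)}"
        using that by (simp add: R_def)
      have "z \<in> closed_segment (Complex (xcoord u) (Re (wcoord u))) (Complex (xcoord v) (Re (wcoord v)))"
        using z by (simp flip: fst_pt)
      then obtain s where s: "0 \<le> s" "s \<le> 1" "Re z = xcoord u + s * (xcoord v - xcoord u)"
          "Im z = Re (wcoord u) + s * (Re (wcoord v) - Re (wcoord u))"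
        by (rule in_segment_coordinates)
      show ?thesis
        unfolding corners using uv s hull by (auto simp: complex_eq_iff)
    qed
  qed
  have crosses: "crosses_above (?p 1) (?q 1) ?c ?d" "crosses_above ?c ?d (?p (-1)) (?q (-1))"
  proof -
    have above: "pt (3/2) (Complex (-1/4) \<epsilon>) \<in> closed_segment (?p \<epsilon>) (?q \<epsilon>)" for \<epsilon>
      unfolding closed_segment_def pt_convex_combination
      by (auto simp: complex_eq_iff intro!: exI[of _ "2/3"])
    have level: "pt (3/2) (-1/4) \<in> closed_segment ?c ?d"
      unfolding closed_segment_def pt_convex_combination
      by (auto simp: complex_eq_iff intro!: exI[of _ "3/4"])
    show "crosses_above (?p 1) (?q 1) ?c ?d"
      unfolding crosses_above_def by (intro bexI[OF _ above] bexI[OF _ level]) (simp add: pt_def)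
    show "crosses_above ?c ?d (?p (-1)) (?q (-1))"
      unfolding crosses_above_def by (intro bexI[OF _ level] bexI[OF _ above]) (simp add: pt_def)
  qed
  have order_p: "fst (?p 1) \<in> open_segment (fst ?a) (fst (?q 1))"
    by (auto simp: in_segment fst_pt complex_eq_iff intro!: exI[of _ "4/7"])
  have order_q: "fst (?q 1) \<in> open_segment (fst (?p 1)) (fst ?b)"
    by (auto simp: in_segment fst_pt complex_eq_iff intro!: exI[of _ "3/4"])
  have sign: "Im (cnj (fst ?b - fst ?a) * (fst ?d - fst ?c)) > 0"
    by (simp add: fst_pt)
  have same: "fst (?p 1) = fst (?p (-1))" "fst (?q 1) = fst (?q (-1))"
    by (simp_all add: fst_pt)
  have diagrams: "link_diagram (Ex 1)" "link_diagram (Ex (-1))" "link_diagram E0"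
    using crossed[of 1] crossed[of "-1"] smoothed by (simp_all add: has_diagram_def)
  have outside': "\<forall>(u, v)\<in>R. closed_segment (fst u) (fst v) \<inter> convex hull {fst ?a, fst ?b, fst ?c, fst ?d} \<subseteq> {fst ?a, fst ?b, fst ?c, fst ?d}"
    using outside by blast
  have "skein_diagrams (Ex 1) (Ex (-1)) E0"
    unfolding skein_diagrams_def
    by (intro conjI diagrams, rule exI[of _ R], rule exI[of _ ?a], rule exI[of _ ?b], rule exI[of _ ?c], rule exI[of _ ?d],
        rule exI[of _ "?p 1"], rule exI[of _ "?q 1"], rule exI[of _ "?p (-1)"], rule exI[of _ "?q (-1)"])
       (intro conjI Ex_def E0_def same order_p order_q outside' sign crosses)
  then show ?thesis
    unfolding skein_triple_def using crossed[of 1] crossed[of "-1"] smoothed by auto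
qed

section \<open>The degree bound along a skein tree\<close>

text \<open>Adding a component multiplies the polynomial by \<open>(a\<^sup>-\<^sup>1 - a) z\<^sup>-\<^sup>1\<close>. This factor lowers the degree and has
  value \<open>1\<close> at the special point.\<close>

lemma round_unlink_bounds:
  assumes P: "homflypt P"
    and "r \<ge> 1"
  shows "deg_z_le (P (round_unlink r)) 0 \<and> special_value (P (round_unlink r)) = 1"
  using \<open>r \<ge> 1\<close>
proof (induction r rule: nat_induct_at_least)
  case base
  have "P (round_unlink 1) = laurent_monom 0 0"
    using P by (simp add: homflypt_def laurent_monom_0_0)
  then show ?case
    by (simp add: deg_z_le_def) (simp add: laurent_monom_def)
next
  case (Suc r)
  let ?f = "P (round_unlink r)" and ?g = "P (round_unlink (Suc r))"
  have rel: "laurent_monom (-1) 0 * ?f - laurent_monom 1 0 * ?f = laurent_monom 0 1 * ?g"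
    using P skein_triple_unlink[OF Suc.hyps] unfolding homflypt_def by blast
  \<comment> \<open>In the Laurent polynomials \<open>z\<close> is invertible, so the skein relation determines the polynomial with one more component.\<close>
  have "?g = laurent_monom 0 (-1) * (laurent_monom 0 1 * ?g)"
    by (simp add: laurent_monom_mult laurent_monom_0_0 flip: mult.assoc)
  also have "\<dots> = laurent_monom (-1) (-1) * ?f - laurent_monom 1 (-1) * ?f"
    unfolding rel[symmetric]
    by (simp add: right_diff_distrib laurent_monom_mult flip: mult.assoc)
  finally have g: "?g = laurent_monom (-1) (-1) * ?f - laurent_monom 1 (-1) * ?f" .
  have "deg_z_le (laurent_monom i (-1) * ?f) 0" for i
    using deg_z_le_monom_mult[of ?f 0 i "-1"] Suc.IH deg_z_le_mono by fastforce
  then have "deg_z_le ?g 0"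
    unfolding g by (intro deg_z_le_diff)
  moreover have "special_value ?g = 1"
    unfolding g using Suc.IH by (simp add: special_value_diff special_value_monom_mult power_int_minus)
  ultimately show ?case by simp
qed

lemma skein_tree_bounds:
  assumes P: "homflypt P"
    and "skein_tree T"
  shows "deg_z_le (P (root T)) (int (depth T)) \<and> special_value (P (root T)) = 1"
  using \<open>skein_tree T\<close>
proof (induction T)
  case (Leaf L)
  then obtain r where r: "r \<ge> 1" "isotopic L (round_unlink r)" and L: "oriented_link L"
    by (auto simp: unlink_def)
  have "oriented_link (round_unlink r)"
    using skein_triple_unlink[OF r(1)] by (auto simp: skein_triple_def has_diagram_def)
  then have "P L = P (round_unlink r)"
    using P L r(2) unfolding homflypt_def by blast
  then show ?case
    using round_unlink_bounds[OF P r(1)] by simp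
next
  case (Node L T1 T2)
  let ?f = "P (root T1)" and ?h = "P (root T2)" and ?d = "int (max (depth T1) (depth T2))"
  have IH: "deg_z_le ?f ?d" "special_value ?f = 1" "deg_z_le ?h ?d" "special_value ?h = 1"
    using Node by (auto intro: deg_z_le_mono)
  have bounds: "deg_z_le (laurent_monom i 0 * ?f) (1 + ?d)" "deg_z_le (laurent_monom i 1 * ?h) (1 + ?d)" for i
    using deg_z_le_monom_mult[OF IH(1), of i 0] deg_z_le_monom_mult[OF IH(3), of i 1]
    by (auto intro: deg_z_le_mono)
  have "skein_triple L (root T1) (root T2) \<or> skein_triple (root T1) L (root T2)"
    using Node.prems by simp
  then have "laurent_monom (-1) 0 * P L - laurent_monom 1 0 * ?f = laurent_monom 0 1 * ?h \<or>
             laurent_monom (-1) 0 * ?f - laurent_monom 1 0 * P L = laurent_monom 0 1 * ?h"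
    using P unfolding homflypt_def by blast
  then have "P L = laurent_monom 2 0 * ?f + laurent_monom 1 1 * ?h \<or>
             P L = laurent_monom (-2) 0 * ?f - laurent_monom (-1) 1 * ?h"
    using skein_relation_solved by blast
  then have "deg_z_le (P L) (1 + ?d) \<and> special_value (P L) = 1"
    using bounds IH by (auto simp: special_value_add special_value_diff special_value_monom_mult power_int_minus deg_z_le_add deg_z_le_diff power2_eq_square)
  then show ?case by simp
qed

theorem proposition4p3:
  fixes P :: "(real \<Rightarrow> space4) set \<Rightarrow> laurent"
    and L :: "(real \<Rightarrow> space4) set"
  assumes "homflypt P"
    and "oriented_link L"
    and "\<not> unlink L"
  shows "ereal_of_enat (skein_tree_depth L) \<ge> ereal (of_int (deg_z (P L)))"
proof -
  let ?d = "deg_z (P L)"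
  \<comment> \<open>Without skein trees the depth is \<open>\<infinity>\<close>; so it suffices to treat every skein tree of the link.\<close>
  have "enat (nat ?d) \<le> skein_tree_depth L"
    unfolding skein_tree_depth_def
  proof (rule INF_greatest)
    fix T
    assume "T \<in> {T. skein_tree T \<and> root T = L}"
    then have "deg_z_le (P L) (int (depth T))" "special_value (P L) = 1"
      using skein_tree_bounds[OF assms(1), of T] by auto
    then have "?d \<le> int (depth T)"
      by (intro deg_z_leI) auto
    then show "enat (nat ?d) \<le> enat (depth T)"
      by simp
  qed
  then have "ereal_of_enat (enat (nat ?d)) \<le> ereal_of_enat (skein_tree_depth L)"
    by (simp only: ereal_of_enat_le_iff)
  moreover have "ereal (of_int ?d) \<le> ereal_of_enat (enat (nat ?d))"
    by simp
  ultimately show ?thesis by (rule order_trans[rotated])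
qed

end
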